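(* The set $\mathrm{EXL}^*=\{e\in\mathbb N : \mathcal L_e \text{ is TxtEx}^*\text{-learnable}\}$, where $\mathcal L_e$ is the uniformly computably enumerable family coded by $e$, is $\Sigma^0_5$-hard: for every $\Sigma^0_5$ predicate $P$ on $\mathbb N$ there is a computable function $h:\mathbb N\to\mathbb N$ such that for all $e$, $P(e)$ holds if and only if $h(e)\in\mathrm{EXL}^*$.
   Context: Fix a computable pairing function $\langle\cdot,\cdot\rangle:\mathbb N^2\to\mathbb N$ and a standard numbering $W_0,W_1,\dots$ of the computably enumerable (c.e.) sets. A number $e$ codes the uniformly computably enumerable (u.c.e.) family $\mathcal L_e=\{L_0,L_1,\dots\}$ whose $i$-th member (column) is $L_i=\{x:\langle i,x\rangle\in W_e\}$; the u.c.e. families are exactly those of this form. Write $A=^*B$ if the symmetric difference $A\triangle B$ is finite. An enumeration is a function $f:\mathbb N\to\mathbb N$; $\mathrm{content}(f)=\{x:(\exists n)\,f(n)=x\}$; $f$ is an enumeration of (for) a set $A$ if $\mathrm{content}(f)=A$. $f\upharpoonright i$ is the initial segment of $f$ of length $i$, a finite string of natural numbers. A learning machine is a (possibly partial) computable function $M$ from finite strings of natural numbers to $\mathbb N$; a statement about a value of $M$ includes that this value is defined. $M$ TxtEx$^*$-identifies an enumeration $f$ if there is $n$ such that $\lim_{i\to\infty}M(f\upharpoonright i)=n$ (i.e. $M(f\upharpoonright i)=n$ for all sufficiently large $i$) and $W_n=^*\mathrm{content}(f)$. $M$ TxtEx$^*$-learns a c.e. set $A$ if it TxtEx$^*$-identifies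 every enumeration of $A$. $M$ TxtEx$^*$-learns a family of c.e. sets if it TxtEx$^*$-learns every member of the family. A family is TxtEx$^*$-learnable if some learning machine TxtEx$^*$-learns it. *)

theory Defs
  imports Main "HOL-Library.Nat_Bijection"
begin

section \<open>Computable functions and c.e. relations\<close>

text \<open>
  Terms for the partial recursive functions. Terms carry no arity: the same term may be applied
  to argument lists of any length, and on lists of a fixed length \<open>k\<close> it computes a \<open>k\<close>-ary partial
  recursive function, undefined where an application makes no sense (such as \<open>Succ\<close> on two arguments).
\<close>

datatype recf =
    Zero
  | Succ
  | Proj nat
  | Comp recf "recf list"
  | PrimRec recf recf
  | Mu recf

inductive evals :: "recf \<Rightarrow> nat list \<Rightarrow> nat \<Rightarrow> bool" where
  Zero: "evals Zero xs 0"
| Succ: "evals Succ [x] (Suc x)"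
| Proj: "i < length xs \<Longrightarrow> evals (Proj i) xs (xs ! i)"
| Comp: "list_all2 (\<lambda>g y. evals g xs y) gs ys \<Longrightarrow> evals f ys z \<Longrightarrow> evals (Comp f gs) xs z"
| PrimRec_0: "evals f xs y \<Longrightarrow> evals (PrimRec f g) (0 # xs) y"
| PrimRec_Suc: "evals (PrimRec f g) (n # xs) r \<Longrightarrow> evals g (n # r # xs) y \<Longrightarrow>
    evals (PrimRec f g) (Suc n # xs) y"
| Mu: "evals f (n # xs) 0 \<Longrightarrow> \<forall>m<n. \<exists>k. evals f (m # xs) (Suc k) \<Longrightarrow> evals (Mu f) xs n"

text \<open>\<open>k\<close>-ary functions and relations live on lists; their values on lists of other lengths are
  irrelevant.\<close>

definition partial_computable :: "nat \<Rightarrow> (nat list \<Rightarrow> nat option) \<Rightarrow> bool" where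
  "partial_computable k f \<longleftrightarrow>
     (\<exists>t. \<forall>xs. length xs = k \<longrightarrow> (\<forall>y. f xs = Some y \<longleftrightarrow> evals t xs y))"

definition computable :: "(nat \<Rightarrow> nat) \<Rightarrow> bool" where
  "computable h \<longleftrightarrow> partial_computable 1 (\<lambda>xs. Some (h (xs ! 0)))"

definition computable_rel :: "nat \<Rightarrow> (nat list \<Rightarrow> bool) \<Rightarrow> bool" where
  "computable_rel k R \<longleftrightarrow> partial_computable k (\<lambda>xs. Some (if R xs then 1 else 0))"

definition ce_rel :: "nat \<Rightarrow> (nat list \<Rightarrow> bool) \<Rightarrow> bool" where
  "ce_rel k R \<longleftrightarrow>
     (\<exists>f. partial_computable k f \<and> (\<forall>xs. length xs = k \<longrightarrow> (R xs \<longleftrightarrow> f xs \<noteq> None)))"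

text \<open>
  A standard (that is, acceptable) numbering of the c.e. sets: it is uniformly c.e., and every
  uniformly c.e. sequence of sets reduces to it computably (s-m-n). In particular every c.e. set
  occurs in it. These are exactly the numberings that are computably equivalent to the numbering
  by domains of the partial recursive functions under a Goedel numbering of the terms above.
\<close>

definition standard_numbering :: "(nat \<Rightarrow> nat set) \<Rightarrow> bool" where
  "standard_numbering W \<longleftrightarrow>
     ce_rel 2 (\<lambda>xs. xs ! 1 \<in> W (xs ! 0)) \<and>
     (\<forall>R. ce_rel 2 R \<longrightarrow> (\<exists>h. computable h \<and> (\<forall>e. W (h e) = {x. R [e, x]})))"


section \<open>The arithmetical hierarchy\<close>

fun sigma_rel :: "nat \<Rightarrow> nat \<Rightarrow> (nat list \<Rightarrow> bool) \<Rightarrow> bool"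
  and pi_rel :: "nat \<Rightarrow> nat \<Rightarrow> (nat list \<Rightarrow> bool) \<Rightarrow> bool" where
  "sigma_rel 0 k R \<longleftrightarrow> computable_rel k R"
| "pi_rel 0 k R \<longleftrightarrow> computable_rel k R"
| "sigma_rel (Suc n) k R \<longleftrightarrow>
     (\<exists>S. pi_rel n (Suc k) S \<and> (\<forall>xs. length xs = k \<longrightarrow> (R xs \<longleftrightarrow> (\<exists>y. S (y # xs)))))"
| "pi_rel (Suc n) k R \<longleftrightarrow>
     (\<exists>S. sigma_rel n (Suc k) S \<and> (\<forall>xs. length xs = k \<longrightarrow> (R xs \<longleftrightarrow> (\<forall>y. S (y # xs)))))"

definition sigma_pred :: "nat \<Rightarrow> (nat \<Rightarrow> bool) \<Rightarrow> bool" where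
  "sigma_pred n P \<longleftrightarrow> sigma_rel n 1 (\<lambda>xs. P (xs ! 0))"


section \<open>Learning from text\<close>

text \<open>The pairing function is the library's Cantor pairing \<open>prod_encode\<close>.\<close>

definition column :: "(nat \<Rightarrow> nat set) \<Rightarrow> nat \<Rightarrow> nat \<Rightarrow> nat set" where
  "column W e i = {x. prod_encode (i, x) \<in> W e}"

definition uce_family :: "(nat \<Rightarrow> nat set) \<Rightarrow> nat \<Rightarrow> nat set set" where
  "uce_family W e = range (column W e)"

definition eq_star :: "'a set \<Rightarrow> 'a set \<Rightarrow> bool" (infix "=\<^sup>*" 50) where
  "A =\<^sup>* B \<longleftrightarrow> finite (sym_diff A B)"

definition enumeration_of :: "(nat \<Rightarrow> nat) \<Rightarrow> nat set \<Rightarrow> bool" where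
  "enumeration_of f A \<longleftrightarrow> range f = A"

definition initial_segment :: "(nat \<Rightarrow> nat) \<Rightarrow> nat \<Rightarrow> nat list" where
  "initial_segment f i = map f [0..<i]"

text \<open>Strings are presented to a machine through the bijection \<open>list_encode\<close>; the value \<open>None\<close>
  means that the machine diverges.\<close>

definition learning_machine :: "(nat list \<Rightarrow> nat option) \<Rightarrow> bool" where
  "learning_machine M \<longleftrightarrow> partial_computable 1 (\<lambda>xs. M (list_decode (xs ! 0)))"

definition txtex_star_identifies ::
    "(nat \<Rightarrow> nat set) \<Rightarrow> (nat list \<Rightarrow> nat option) \<Rightarrow> (nat \<Rightarrow> nat) \<Rightarrow> bool" where
  "txtex_star_identifies W M f \<longleftrightarrow>
     (\<exists>n. (\<exists>N. \<forall>i\<ge>N. M (initial_segment f i) = Some n) \<and> W n =\<^sup>* range f)"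

definition txtex_star_learns_set ::
    "(nat \<Rightarrow> nat set) \<Rightarrow> (nat list \<Rightarrow> nat option) \<Rightarrow> nat set \<Rightarrow> bool" where
  "txtex_star_learns_set W M A \<longleftrightarrow> (\<forall>f. enumeration_of f A \<longrightarrow> txtex_star_identifies W M f)"

definition txtex_star_learns_family ::
    "(nat \<Rightarrow> nat set) \<Rightarrow> (nat list \<Rightarrow> nat option) \<Rightarrow> nat set set \<Rightarrow> bool" where
  "txtex_star_learns_family W M F \<longleftrightarrow> (\<forall>A\<in>F. txtex_star_learns_set W M A)"

definition txtex_star_learnable :: "(nat \<Rightarrow> nat set) \<Rightarrow> nat set set \<Rightarrow> bool" where
  "txtex_star_learnable W F \<longleftrightarrow> (\<exists>M. learning_machine M \<and> txtex_star_learns_family W M F)"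

definition EXL_star :: "(nat \<Rightarrow> nat set) \<Rightarrow> nat set" where
  "EXL_star W = {e. txtex_star_learnable W (uce_family W e)}"

end

(*
  Write the given predicate as "there is a such that for all b: T(a, b)" with T a Sigma_3 predicate,
  and code T(a, (y)_a) for some a <= x into the cofiniteness of a c.e. set V(e, x, y). If P(e) holds,
  then V(e, x, y) is cofinite for almost all x and all y; otherwise for every x some V(e, x, y) is
  coinfinite.

  The family consists of parts tagged by x, the x-th part being directed against the x-th machine. The
  construction searches for ever longer strings of x-tagged numbers along which the machine changes its
  mind, and at each success raises a bound b above everything seen so far. Column 0 of part x is
  everything; column y + 1 consists of the numbers below b, the marker b + y + 1 and the elements of
  V(e, x, y) above it. If b grows forever, the machine has no limit on a text for column 0, and all columns
  coincide. If b settles, the machine has locked its conjecture and cannot tell column 0 from column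
  y + 1, so it fails as soon as V(e, x, y) is coinfinite.

  Conversely, if P(e) holds, a learner that knows the final bounds of the finitely many remaining parts
  identifies the column there by its least element above the bound; in all other parts all columns
  agree up to finitely many elements.
*)
theory Submission
  imports Defs "HOL-Library.Sublist"
begin

section \<open>Computable functions, decidable and semidecidable predicates\<close>

abbreviation total_computable :: "nat \<Rightarrow> (nat list \<Rightarrow> nat) \<Rightarrow> bool" where
  "total_computable k F \<equiv> partial_computable k (\<lambda>xs. Some (F xs))"

lemma total_computableI:
  assumes "\<And>xs y. length xs = k \<Longrightarrow> evals t xs y \<longleftrightarrow> y = F xs"
  shows "total_computable k F"
  unfolding partial_computable_def using assms by (intro exI[of _ t]) auto

lemma total_computableE:
  assumes "total_computable k F"
  obtains t where "\<forall>xs y. length xs = k \<longrightarrow> (evals t xs y \<longleftrightarrow> y = F xs)"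
  using assms unfolding partial_computable_def by (metis option.inject)

lemma total_computable_cong:
  assumes "total_computable k F" "\<And>xs. length xs = k \<Longrightarrow> F xs = G xs"
  shows "total_computable k G"
  using assms unfolding partial_computable_def by auto

section \<open>Evaluation rules as equivalences\<close>

inductive_cases evals_ZeroE: "evals Zero xs y"
inductive_cases evals_SuccE: "evals Succ xs y"
inductive_cases evals_ProjE: "evals (Proj i) xs y"
inductive_cases evals_CompE: "evals (Comp f gs) xs y"
inductive_cases evals_PrimRecE: "evals (PrimRec f g) xs y"
inductive_cases evals_MuE: "evals (Mu f) xs y"

lemma evals_Zero_iff: "evals Zero xs y \<longleftrightarrow> y = 0"
  by (auto intro: evals.Zero elim: evals_ZeroE)

lemma evals_Succ_iff: "evals Succ xs y \<longleftrightarrow> (\<exists>x. xs = [x] \<and> y = Suc x)"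
  by (auto intro: evals.Succ elim: evals_SuccE)

lemma evals_Proj_iff: "evals (Proj i) xs y \<longleftrightarrow> i < length xs \<and> y = xs ! i"
  by (auto intro: evals.Proj elim: evals_ProjE)

lemma evals_Comp_iff:
  "evals (Comp f gs) xs z \<longleftrightarrow> (\<exists>ys. list_all2 (\<lambda>g y. evals g xs y) gs ys \<and> evals f ys z)"
  by (auto intro: evals.Comp elim: evals_CompE)

lemma evals_Mu_iff:
  "evals (Mu f) xs n \<longleftrightarrow> evals f (n # xs) 0 \<and> (\<forall>m<n. \<exists>k. evals f (m # xs) (Suc k))"
  by (auto intro: evals.Mu elim: evals_MuE)

lemma evals_PrimRec_0_iff: "evals (PrimRec f g) (0 # xs) y \<longleftrightarrow> evals f xs y"
  by (auto intro: evals.PrimRec_0 elim: evals_PrimRecE)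

lemma evals_PrimRec_Suc_iff:
  "evals (PrimRec f g) (Suc n # xs) y \<longleftrightarrow>
     (\<exists>r. evals (PrimRec f g) (n # xs) r \<and> evals g (n # r # xs) y)"
  by (auto intro: evals.PrimRec_Suc elim: evals_PrimRecE)

lemma evals_PrimRec_Nil_iff: "\<not> evals (PrimRec f g) [] y"
  by (auto elim: evals_PrimRecE)

section \<open>Total functions closed under composition and primitive recursion\<close>

lemma total_computable_Zero: "total_computable k (\<lambda>_. 0)"
  by (rule total_computableI[of _ Zero]) (simp add: evals_Zero_iff)

lemma total_computable_Succ: "total_computable 1 (\<lambda>xs. Suc (xs ! 0))"
  by (rule total_computableI[of _ Succ]) (auto simp: evals_Succ_iff length_Suc_conv)

lemma total_computable_Proj: "i < k \<Longrightarrow> total_computable k (\<lambda>xs. xs ! i)"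
  by (rule total_computableI[of _ "Proj i"]) (auto simp: evals_Proj_iff)

lemma total_computable_Comp:
  assumes F: "total_computable (length Gs) F" and G: "\<And>G. G \<in> set Gs \<Longrightarrow> total_computable k G"
  shows "total_computable k (\<lambda>xs. F (map (\<lambda>G. G xs) Gs))"
proof -
  obtain f where f: "\<forall>xs y. length xs = length Gs \<longrightarrow> (evals f xs y \<longleftrightarrow> y = F xs)"
    by (rule total_computableE[OF F])
  have "\<forall>G\<in>set Gs. \<exists>g. \<forall>xs y. length xs = k \<longrightarrow> (evals g xs y \<longleftrightarrow> y = G xs)"
  proof
    fix H assume "H \<in> set Gs"
    then show "\<exists>g. \<forall>xs y. length xs = k \<longrightarrow> (evals g xs y \<longleftrightarrow> y = H xs)"
      by (blast intro: total_computableE[OF G])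
  qed
  then obtain g where g: "\<And>G xs y. G \<in> set Gs \<Longrightarrow> length xs = k \<Longrightarrow> evals (g G) xs y \<longleftrightarrow> y = G xs"
    by metis
  show ?thesis
  proof (rule total_computableI[of _ "Comp f (map g Gs)"])
    fix xs :: "nat list" and y
    assume "length xs = k"
    \<comment> \<open>Totality of the inner functions leaves exactly one list of intermediate
      values.\<close>
    then have "list_all2 (\<lambda>h y. evals h xs y) (map g Gs) ys \<longleftrightarrow> ys = map (\<lambda>G. G xs) Gs" for ys
      using g by (auto simp: list_all2_conv_all_nth list_eq_iff_nth_eq)
    then show "evals (Comp f (map g Gs)) xs y \<longleftrightarrow> y = F (map (\<lambda>G. G xs) Gs)"
      by (simp add: evals_Comp_iff f)
  qed
qed

lemma total_computable_Comp1:
  assumes "total_computable 1 (\<lambda>xs. f (xs ! 0))" "total_computable k a"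
  shows "total_computable k (\<lambda>xs. f (a xs))"
  using total_computable_Comp[of "[a]" "\<lambda>xs. f (xs ! 0)" k] assms by simp

lemma total_computable_Comp2:
  assumes "total_computable 2 (\<lambda>xs. f (xs ! 0) (xs ! 1))" "total_computable k a" "total_computable k b"
  shows "total_computable k (\<lambda>xs. f (a xs) (b xs))"
  using total_computable_Comp[of "[a, b]" "\<lambda>xs. f (xs ! 0) (xs ! 1)" k] assms
  by (auto simp: numeral_2_eq_2)

lemma total_computable_PrimRec:
  assumes A: "total_computable k A" and G: "total_computable (Suc (Suc k)) G"
  shows "total_computable (Suc k) (\<lambda>xs. rec_nat (A (tl xs)) (\<lambda>n r. G (n # r # tl xs)) (xs ! 0))"
proof -
  obtain f where f: "\<forall>xs y. length xs = k \<longrightarrow> (evals f xs y \<longleftrightarrow> y = A xs)"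
    by (rule total_computableE[OF A])
  obtain g where g: "\<forall>xs y. length xs = Suc (Suc k) \<longrightarrow> (evals g xs y \<longleftrightarrow> y = G xs)"
    by (rule total_computableE[OF G])
  have "evals (PrimRec f g) (n # xs) y \<longleftrightarrow> y = rec_nat (A xs) (\<lambda>n r. G (n # r # xs)) n"
    if "length xs = k" for n xs y
    using that by (induction n arbitrary: y) (auto simp: f g evals_PrimRec_0_iff evals_PrimRec_Suc_iff)
  then show ?thesis
    by (intro total_computableI[of _ "PrimRec f g"]) (auto simp: length_Suc_conv)
qed

lemma computable_iff: "computable h \<longleftrightarrow> (\<exists>t. \<forall>x y. evals t [x] y \<longleftrightarrow> y = h x)"
proof -
  have "(\<forall>xs. length xs = 1 \<longrightarrow> (\<forall>y. Some (h (xs ! 0)) = Some y \<longleftrightarrow> evals t xs y)) \<longleftrightarrow>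
      (\<forall>x y. evals t [x] y \<longleftrightarrow> y = h x)" for t
  proof -
    have "(\<forall>xs. length xs = 1 \<longrightarrow> Q xs) \<longleftrightarrow> (\<forall>x. Q [x])" for Q :: "nat list \<Rightarrow> bool"
      by (auto simp: length_Suc_conv)
    from this[of "\<lambda>xs. \<forall>y. Some (h (xs ! 0)) = Some y \<longleftrightarrow> evals t xs y"] show ?thesis
      by (simp, metis)
  qed
  then show ?thesis
    unfolding computable_def partial_computable_def by presburger
qed

section \<open>Arithmetic and the inverse of the Cantor pairing\<close>

lemma total_computable_Suc: "total_computable k a \<Longrightarrow> total_computable k (\<lambda>xs. Suc (a xs))"
  by (rule total_computable_Comp1[OF total_computable_Succ])

lemma total_computable_add:
  assumes "total_computable k a" "total_computable k b"
  shows "total_computable k (\<lambda>xs. a xs + b xs)"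
proof (rule total_computable_Comp2[OF _ assms])
  have "total_computable (Suc 1) (\<lambda>xs. rec_nat (tl xs ! 0) (\<lambda>n r. Suc ((n # r # tl xs) ! 1)) (xs ! 0))"
    by (intro total_computable_PrimRec total_computable_Suc total_computable_Proj) auto
  moreover have "rec_nat m (\<lambda>n r. Suc r) n = n + m" for m n
    by (induction n) auto
  ultimately show "total_computable 2 (\<lambda>xs. xs ! 0 + xs ! 1)"
    unfolding numeral_2_eq_2 One_nat_def
    by (elim total_computable_cong) (auto simp: length_Suc_conv)
qed

lemma total_computable_diff:
  assumes "total_computable k a" "total_computable k b"
  shows "total_computable k (\<lambda>xs. a xs - b xs)"
proof -
  have "total_computable (Suc 0) (\<lambda>xs. rec_nat 0 (\<lambda>n r. (n # r # tl xs) ! 0) (xs ! 0))"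
    by (intro total_computable_PrimRec total_computable_Zero total_computable_Proj) auto
  moreover have "rec_nat 0 (\<lambda>n r. n) n = n - 1" for n :: nat
    by (cases n) auto
  ultimately have "total_computable 1 (\<lambda>xs. xs ! 0 - 1)"
    by simp
  then have pred: "total_computable j f \<Longrightarrow> total_computable j (\<lambda>xs. f xs - 1)" for j f
    by (rule total_computable_Comp1)
  \<comment> \<open>Subtraction iterates the predecessor. The recursion runs on the head of the
    list, so the subtrahend comes first; the final composition swaps the arguments back.\<close>
  have "total_computable (Suc 1) (\<lambda>xs. rec_nat (tl xs ! 0) (\<lambda>n r. (n # r # tl xs) ! 1 - 1) (xs ! 0))"
    by (intro total_computable_PrimRec pred total_computable_Proj) auto
  moreover have "rec_nat m (\<lambda>n r. r - 1) n = m - n" for m n :: nat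
    by (induction n) auto
  ultimately have "total_computable 2 (\<lambda>xs. xs ! 1 - xs ! 0)"
    unfolding numeral_2_eq_2 One_nat_def
    by (elim total_computable_cong) (auto simp: length_Suc_conv)
  from total_computable_Comp2[OF this assms(2,1)] show ?thesis .
qed

lemma total_computable_triangle:
  assumes "total_computable k a"
  shows "total_computable k (\<lambda>xs. triangle (a xs))"
proof (rule total_computable_Comp1[OF _ assms])
  have "total_computable (Suc 0)
      (\<lambda>xs. rec_nat 0 (\<lambda>n r. (n # r # tl xs) ! 1 + Suc ((n # r # tl xs) ! 0)) (xs ! 0))"
    by (intro total_computable_PrimRec total_computable_Zero total_computable_add
        total_computable_Suc total_computable_Proj) auto
  moreover have "rec_nat 0 (\<lambda>n r. r + Suc n) n = triangle n" for n
    by (induction n) auto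
  ultimately show "total_computable 1 (\<lambda>xs. triangle (xs ! 0))"
    by simp
qed

lemma total_computable_prod_encode:
  assumes "total_computable k a" "total_computable k b"
  shows "total_computable k (\<lambda>xs. prod_encode (a xs, b xs))"
  unfolding prod_encode_def prod.case
  by (intro total_computable_add total_computable_triangle assms)

text \<open>The number of the diagonal on which \<open>z\<close> lies in the Cantor pairing. The
  recursion moves to the next diagonal exactly when \<open>Suc n\<close> reaches its first point;
  the nested truncated subtraction is the characteristic function of that test.\<close>

definition triangle_root :: "nat \<Rightarrow> nat" where
  "triangle_root z = rec_nat 0 (\<lambda>n r. r + (1 - (triangle (Suc r) - Suc n))) z"

lemma total_computable_triangle_root:
  assumes "total_computable k a"
  shows "total_computable k (\<lambda>xs. triangle_root (a xs))"
proof (rule total_computable_Comp1[OF _ assms])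
  have "total_computable (Suc 0) (\<lambda>xs. rec_nat 0 (\<lambda>n r. (n # r # tl xs) ! 1 +
      (Suc 0 - (triangle (Suc ((n # r # tl xs) ! 1)) - Suc ((n # r # tl xs) ! 0)))) (xs ! 0))"
    by (intro total_computable_PrimRec total_computable_Zero total_computable_add
        total_computable_Suc total_computable_triangle total_computable_diff total_computable_Proj) auto
  then show "total_computable 1 (\<lambda>xs. triangle_root (xs ! 0))"
    by (simp add: triangle_root_def del: triangle_Suc)
qed

lemma triangle_root_bounds:
  "triangle (triangle_root z) \<le> z \<and> z < triangle (Suc (triangle_root z))"
proof (induction z)
  case (Suc z)
  have "triangle_root (Suc z) =
      (if triangle (Suc (triangle_root z)) \<le> Suc z then Suc (triangle_root z) else triangle_root z)"
    by (auto simp: triangle_root_def simp del: triangle_Suc)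
  with Suc show ?case
    by (cases "triangle (Suc (triangle_root z)) \<le> Suc z") auto
qed (simp add: triangle_root_def)

text \<open>Since \<open>prod_encode (m, n)\<close> is \<open>triangle (m + n) + m\<close>, the root
  recovers \<open>m + n\<close> and the excess over its triangle number recovers \<open>m\<close>.
  Both projections thereby become arithmetical expressions.\<close>

lemma prod_decode_triangle_root:
  "prod_decode z = (z - triangle (triangle_root z), triangle_root z - (z - triangle (triangle_root z)))"
proof -
  have "z = prod_encode (z - triangle (triangle_root z), triangle_root z - (z - triangle (triangle_root z)))"
    using triangle_root_bounds[of z] by (auto simp: prod_encode_def)
  then show ?thesis
    by (metis prod_encode_inverse)
qed

section \<open>Unary functions, with pairing in place of several arguments\<close>

lemma computable_comp: "computable f \<Longrightarrow> computable a \<Longrightarrow> computable (\<lambda>z. f (a z))"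
  unfolding computable_def by (rule total_computable_Comp1)

lemma computable_const: "computable (\<lambda>_. c)"
  unfolding computable_def
  by (induction c) (auto intro: total_computable_Zero total_computable_Suc)

lemma computable_id: "computable (\<lambda>z. z)"
  unfolding computable_def by (rule total_computable_Proj) simp

lemma computable_Suc: "computable a \<Longrightarrow> computable (\<lambda>z. Suc (a z))"
  unfolding computable_def by (rule total_computable_Suc)

lemma computable_add: "computable a \<Longrightarrow> computable b \<Longrightarrow> computable (\<lambda>z. a z + b z)"
  unfolding computable_def by (rule total_computable_add)

lemma computable_diff: "computable a \<Longrightarrow> computable b \<Longrightarrow> computable (\<lambda>z. a z - b z)"
  unfolding computable_def by (rule total_computable_diff)

lemma computable_prod_encode:
  "computable a \<Longrightarrow> computable b \<Longrightarrow> computable (\<lambda>z. prod_encode (a z, b z))"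
  unfolding computable_def by (rule total_computable_prod_encode)

lemma computable_fst: "computable a \<Longrightarrow> computable (\<lambda>z. fst (prod_decode (a z)))"
  unfolding computable_def prod_decode_triangle_root fst_conv
  by (intro total_computable_diff total_computable_triangle total_computable_triangle_root)

lemma computable_snd: "computable a \<Longrightarrow> computable (\<lambda>z. snd (prod_decode (a z)))"
  unfolding computable_def prod_decode_triangle_root snd_conv
  by (intro total_computable_diff total_computable_triangle total_computable_triangle_root)

lemma total_computable_arg:
  assumes "computable f" "total_computable k a"
  shows "total_computable k (\<lambda>xs. f (a xs))"
  using assms unfolding computable_def by (rule total_computable_Comp1)

text \<open>The three arguments of the recursion step (counter, previous value, parameter) are
  packed into one number \<open>u\<close>, so that computability of unary functions is the only
  notion that the closure rules mention.\<close>

lemma computable_rec_nat: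
  assumes "computable A" "computable (\<lambda>u. G (fst (prod_decode u)) (fst (prod_decode (snd (prod_decode u))))
                                           (snd (prod_decode (snd (prod_decode u)))))"
    "computable b"
  shows "computable (\<lambda>z. rec_nat (A z) (\<lambda>n r. G n r z) (b z))"
proof -
  have "total_computable (Suc 1)
    (\<lambda>xs. rec_nat (A (tl xs ! 0)) (\<lambda>n r.
       (\<lambda>u. G (fst (prod_decode u)) (fst (prod_decode (snd (prod_decode u)))) (snd (prod_decode (snd (prod_decode u)))))
       (prod_encode ((n # r # tl xs) ! 0, prod_encode ((n # r # tl xs) ! 1, (n # r # tl xs) ! 2)))) (xs ! 0))"
    by (intro total_computable_PrimRec total_computable_arg[OF assms(1)] total_computable_arg[OF assms(2)]
       total_computable_prod_encode total_computable_Proj) auto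
  then have "total_computable 2 (\<lambda>xs. rec_nat (A (xs ! 1)) (\<lambda>n r. G n r (xs ! 1)) (xs ! 0))"
    unfolding numeral_2_eq_2 One_nat_def
    by (elim total_computable_cong) (auto simp: length_Suc_conv)
  then have "total_computable 1 (\<lambda>xs. rec_nat (A (xs ! 0)) (\<lambda>n r. G n r (xs ! 0)) (b (xs ! 0)))"
    by (rule total_computable_Comp2) (use assms(3) in \<open>auto intro: total_computable_Proj simp: computable_def\<close>)
  then show ?thesis
    by (simp add: computable_def)
qed

section \<open>Decidable and semidecidable predicates and their closure properties\<close>

definition decidable :: "(nat \<Rightarrow> bool) \<Rightarrow> bool" where
  "decidable P \<longleftrightarrow> computable (\<lambda>z. if P z then 1 else 0)"

text \<open>The existential form is preferred to domains of partial functions because closure under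
  connectives and quantifiers then only rearranges witnesses.\<close>

definition semidecidable :: "(nat \<Rightarrow> bool) \<Rightarrow> bool" where
  "semidecidable P \<longleftrightarrow> (\<exists>A. decidable A \<and> (\<forall>z. P z \<longleftrightarrow> (\<exists>w. A (prod_encode (w, z)))))"

text \<open>Under a quantifier the old parameter becomes the second component of a new one; this
  carries computability hypotheses into that context.\<close>

lemma computable_snd_comp: "computable f \<Longrightarrow> computable (\<lambda>u. f (snd (prod_decode u)))"
  by (erule computable_comp) (intro computable_snd computable_id)

lemma decidable_comp: "decidable P \<Longrightarrow> computable a \<Longrightarrow> decidable (\<lambda>z. P (a z))"
  unfolding decidable_def by (rule computable_comp)

lemma decidable_const: "decidable (\<lambda>_. b)"
  unfolding decidable_def by (rule computable_const)

lemma decidable_not: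
  assumes "decidable P"
  shows "decidable (\<lambda>z. \<not> P z)"
proof -
  have "computable (\<lambda>z. 1 - (if P z then 1 else 0))"
    using assms unfolding decidable_def by (intro computable_diff computable_const)
  moreover have "(\<lambda>z. 1 - (if P z then 1 else 0)) = (\<lambda>z. if \<not> P z then 1 else (0::nat))"
    by auto
  ultimately show ?thesis by (simp add: decidable_def)
qed

lemma decidable_zero:
  assumes "computable a"
  shows "decidable (\<lambda>z. a z = 0)"
proof -
  have "computable (\<lambda>z. 1 - a z)"
    using assms by (intro computable_diff computable_const)
  moreover have "(\<lambda>z. 1 - a z) = (\<lambda>z. if a z = 0 then 1 else 0)"
    by auto
  ultimately show ?thesis by (simp add: decidable_def)
qed

lemma decidable_le:
  assumes "computable a" "computable b"
  shows "decidable (\<lambda>z. a z \<le> b z)"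
  using decidable_zero[OF computable_diff[OF assms]] by simp

lemma decidable_less:
  assumes "computable a" "computable b"
  shows "decidable (\<lambda>z. a z < b z)"
  using decidable_le[OF computable_Suc[OF assms(1)] assms(2)] by (simp add: Suc_le_eq)

lemma computable_If:
  assumes "decidable P" "computable a" "computable b"
  shows "computable (\<lambda>z. if P z then a z else b z)"
proof -
  \<comment> \<open>A recursion of length zero or one, governed by the characteristic function,
    selects the branch.\<close>
  have "computable (\<lambda>z. rec_nat (b z) (\<lambda>n r. a z) (if P z then 1 else 0))"
    using assms unfolding decidable_def
    by (intro computable_rec_nat computable_snd_comp[of "\<lambda>u. a (snd (prod_decode u))"] computable_snd_comp[of a])
  moreover have "(\<lambda>z. rec_nat (b z) (\<lambda>n r. a z) (if P z then 1 else 0)) = (\<lambda>z. if P z then a z else b z)"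
    by auto
  ultimately show ?thesis by simp
qed

lemma decidable_conj:
  assumes "decidable P" "decidable Q"
  shows "decidable (\<lambda>z. P z \<and> Q z)"
proof -
  have "computable (\<lambda>z. if P z then if Q z then 1 else 0 else 0)"
    using assms by (intro computable_If computable_const)
  moreover have "(\<lambda>z. if P z then if Q z then 1 else 0 else 0) = (\<lambda>z. if P z \<and> Q z then 1 else (0::nat))"
    by auto
  ultimately show ?thesis by (simp add: decidable_def)
qed

lemma decidable_disj:
  assumes "decidable P" "decidable Q"
  shows "decidable (\<lambda>z. P z \<or> Q z)"
  using decidable_not[OF decidable_conj[OF decidable_not[OF assms(1)] decidable_not[OF assms(2)]]]
  by simp

lemma decidable_imp:
  assumes "decidable P" "decidable Q"
  shows "decidable (\<lambda>z. P z \<longrightarrow> Q z)"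
  using decidable_disj[OF decidable_not[OF assms(1)] assms(2)] by simp

lemma decidable_eq:
  assumes "computable a" "computable b"
  shows "decidable (\<lambda>z. a z = b z)"
proof -
  have "(\<lambda>z. a z = b z) = (\<lambda>z. a z \<le> b z \<and> b z \<le> a z)"
    by auto
  then show ?thesis
    by (simp only: decidable_conj decidable_le assms)
qed

lemma decidable_ball:
  assumes "computable b" "decidable (\<lambda>u. P (fst (prod_decode u)) (snd (prod_decode u)))"
  shows "decidable (\<lambda>z. \<forall>i<b z. P i z)"
proof -
  have P: "decidable (\<lambda>z. P (a z) (c z))" if "computable a" "computable c" for a c
    using decidable_comp[OF assms(2) computable_prod_encode[OF that]] by simp
  have "computable (\<lambda>z. rec_nat 1 (\<lambda>n r. if P n z then r else 0) (b z))"
    by (intro computable_rec_nat computable_If computable_const P assms(1)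
        computable_fst computable_snd computable_id)
  moreover have "rec_nat (1::nat) (\<lambda>n r. if P n z then r else 0) k = (if \<forall>i<k. P i z then 1 else 0)" for k z
    by (induction k) (auto simp: less_Suc_eq)
  ultimately show ?thesis by (simp only: decidable_def)
qed

lemma decidable_bex:
  assumes "computable b" "decidable (\<lambda>u. P (fst (prod_decode u)) (snd (prod_decode u)))"
  shows "decidable (\<lambda>z. \<exists>i<b z. P i z)"
  using decidable_not[OF decidable_ball[OF assms(1) decidable_not[OF assms(2)]]] by simp

text \<open>For a total function the requirement of \<open>Mu\<close> that all earlier values be
  defined and positive reduces to their being nonzero.\<close>

lemma evals_Mu_total:
  assumes "total_computable (Suc k) F"
  shows "\<exists>t. \<forall>xs n. length xs = k \<longrightarrow>
    (evals t xs n \<longleftrightarrow> F (n # xs) = 0 \<and> (\<forall>m<n. F (m # xs) \<noteq> 0))"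
proof -
  obtain f where f: "\<forall>xs y. length xs = Suc k \<longrightarrow> (evals f xs y \<longleftrightarrow> y = F xs)"
    by (rule total_computableE[OF assms])
  have "evals (Mu f) xs n \<longleftrightarrow> F (n # xs) = 0 \<and> (\<forall>m<n. F (m # xs) \<noteq> 0)" if "length xs = k" for xs n
  proof -
    have ev: "evals f (m # xs) y \<longleftrightarrow> y = F (m # xs)" for m y
      using f that by simp
    show ?thesis
      unfolding evals_Mu_iff ev by (metis not0_implies_Suc nat.distinct(1))
  qed
  then show ?thesis
    by blast
qed

lemma computable_Least:
  assumes "decidable (\<lambda>u. P (fst (prod_decode u)) (snd (prod_decode u)))" "\<And>z. \<exists>n. P n z"
  shows "computable (\<lambda>z. LEAST n. P n z)"
proof -
  \<comment> \<open>\<open>Mu\<close> looks for a zero, hence the characteristic function of the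
    negation.\<close>
  have "total_computable (Suc 1) (\<lambda>xs. (\<lambda>u. if \<not> P (fst (prod_decode u)) (snd (prod_decode u)) then 1 else 0)
      (prod_encode (xs ! 0, xs ! 1)))"
    by (rule total_computable_arg)
      (use decidable_not[OF assms(1)] in \<open>auto simp: decidable_def intro!: total_computable_prod_encode total_computable_Proj\<close>)
  then have "total_computable (Suc 1) (\<lambda>xs. if P (xs ! 0) (xs ! 1) then 0 else 1)"
    by (rule total_computable_cong) auto
  from evals_Mu_total[OF this[unfolded One_nat_def]] obtain t where "\<forall>xs n. length xs = Suc 0 \<longrightarrow>
    (evals t xs n \<longleftrightarrow> (if P ((n # xs) ! 0) ((n # xs) ! Suc 0) then 0 else Suc 0) = 0 \<and>
     (\<forall>m<n. (if P ((m # xs) ! 0) ((m # xs) ! Suc 0) then 0 else Suc 0) \<noteq> 0))" ..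
  have t: "evals t [z] n \<longleftrightarrow> P n z \<and> (\<forall>m<n. \<not> P m z)" for z n
    by (simp add: \<open>\<forall>xs n. _\<close>) blast
  have "evals t [z] n \<longleftrightarrow> n = (LEAST n. P n z)" for z n
    unfolding t
  proof
    assume *: "P n z \<and> (\<forall>m<n. \<not> P m z)"
    have "(LEAST n. P n z) = n"
      by (rule Least_equality) (use * in \<open>auto simp: not_less[symmetric]\<close>)
    then show "n = (LEAST n. P n z)" ..
  next
    assume "n = (LEAST n. P n z)"
    then show "P n z \<and> (\<forall>m<n. \<not> P m z)"
      using LeastI_ex[OF assms(2)[of z]] not_less_Least[of _ "\<lambda>n. P n z"] by blast
  qed
  then show ?thesis
    unfolding computable_iff by blast
qed

lemma semidecidable_decidable:
  assumes "decidable P"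
  shows "semidecidable P"
  unfolding semidecidable_def
  by (intro exI[of _ "\<lambda>u. P (snd (prod_decode u))"] conjI decidable_comp[OF assms] computable_snd
      computable_id) simp

lemma semidecidable_comp:
  assumes "semidecidable P" "computable a"
  shows "semidecidable (\<lambda>z. P (a z))"
proof -
  obtain A where A: "decidable A" "\<And>z. P z \<longleftrightarrow> (\<exists>w. A (prod_encode (w, z)))"
    using assms(1) by (auto simp: semidecidable_def)
  show ?thesis
    unfolding semidecidable_def
    by (intro exI[of _ "\<lambda>u. A (prod_encode (fst (prod_decode u), a (snd (prod_decode u))))"] conjI
        decidable_comp[OF A(1)] computable_prod_encode computable_comp[OF assms(2)]
        computable_fst computable_snd computable_id) (simp add: A(2))
qed

lemma semidecidable_conj:
  assumes "semidecidable P" "semidecidable Q"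
  shows "semidecidable (\<lambda>z. P z \<and> Q z)"
proof -
  obtain A where A: "decidable A" "\<And>z. P z \<longleftrightarrow> (\<exists>w. A (prod_encode (w, z)))"
    using assms(1) by (auto simp: semidecidable_def)
  obtain B where B: "decidable B" "\<And>z. Q z \<longleftrightarrow> (\<exists>w. B (prod_encode (w, z)))"
    using assms(2) by (auto simp: semidecidable_def)
  have "(P z \<and> Q z) \<longleftrightarrow>
      (\<exists>w. A (prod_encode (fst (prod_decode w), z)) \<and> B (prod_encode (snd (prod_decode w), z)))" for z
    unfolding A(2) B(2) by (metis prod_encode_inverse fst_conv snd_conv)
  then show ?thesis
    unfolding semidecidable_def
    by (intro exI[of _ "\<lambda>u. A (prod_encode (fst (prod_decode (fst (prod_decode u))), snd (prod_decode u))) \<and>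
        B (prod_encode (snd (prod_decode (fst (prod_decode u))), snd (prod_decode u)))"] conjI
        decidable_conj decidable_comp[OF A(1)] decidable_comp[OF B(1)] computable_prod_encode
        computable_fst computable_snd computable_id) simp
qed

lemma semidecidable_disj:
  assumes "semidecidable P" "semidecidable Q"
  shows "semidecidable (\<lambda>z. P z \<or> Q z)"
proof -
  obtain A where A: "decidable A" "\<And>z. P z \<longleftrightarrow> (\<exists>w. A (prod_encode (w, z)))"
    using assms(1) by (auto simp: semidecidable_def)
  obtain B where B: "decidable B" "\<And>z. Q z \<longleftrightarrow> (\<exists>w. B (prod_encode (w, z)))"
    using assms(2) by (auto simp: semidecidable_def)
  show ?thesis
    unfolding semidecidable_def
    by (intro exI[of _ "\<lambda>u. A u \<or> B u"] conjI decidable_disj A(1) B(1)) (auto simp: A(2) B(2))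
qed

lemma semidecidable_ex:
  assumes "semidecidable (\<lambda>u. P (fst (prod_decode u)) (snd (prod_decode u)))"
  shows "semidecidable (\<lambda>z. \<exists>y. P y z)"
proof -
  obtain A where A: "decidable A"
    "\<And>u. P (fst (prod_decode u)) (snd (prod_decode u)) \<longleftrightarrow> (\<exists>w. A (prod_encode (w, u)))"
    using assms by (auto simp: semidecidable_def)
  have "P y z \<longleftrightarrow> (\<exists>w. A (prod_encode (w, prod_encode (y, z))))" for y z
    using A(2)[of "prod_encode (y, z)"] by simp
  then have "(\<exists>y. P y z) \<longleftrightarrow>
      (\<exists>w. A (prod_encode (snd (prod_decode w), prod_encode (fst (prod_decode w), z))))" for z
    by (metis prod_encode_inverse fst_conv snd_conv)
  then show ?thesis
    unfolding semidecidable_def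
    by (intro exI[of _ "\<lambda>u. A (prod_encode (snd (prod_decode (fst (prod_decode u))),
        prod_encode (fst (prod_decode (fst (prod_decode u))), snd (prod_decode u))))"] conjI
        decidable_comp[OF A(1)] computable_prod_encode
        computable_fst computable_snd computable_id) simp
qed

text \<open>Finitely many witnesses have a common bound \<open>W\<close>. Quantifying over
  \<open>W\<close> first turns the search for the individual witnesses into a bounded, hence
  decidable, one.\<close>

lemma semidecidable_ball:
  assumes "computable b" "semidecidable (\<lambda>u. P (fst (prod_decode u)) (snd (prod_decode u)))"
  shows "semidecidable (\<lambda>z. \<forall>i<b z. P i z)"
proof -
  obtain A where A: "decidable A"
    "\<And>u. P (fst (prod_decode u)) (snd (prod_decode u)) \<longleftrightarrow> (\<exists>w. A (prod_encode (w, u)))"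
    using assms by (auto simp: semidecidable_def)
  have P: "P y z \<longleftrightarrow> (\<exists>w. A (prod_encode (w, prod_encode (y, z))))" for y z
    using A(2)[of "prod_encode (y, z)"] by simp
  have eq: "(\<forall>i<b z. P i z) \<longleftrightarrow> (\<exists>W. \<forall>i<b z. \<exists>w<W. A (prod_encode (w, prod_encode (i, z))))" for z
  proof
    assume "\<forall>i<b z. P i z"
    then obtain w where w: "\<And>i. i < b z \<Longrightarrow> A (prod_encode (w i, prod_encode (i, z)))"
      unfolding P by metis
    have "w i < Suc (Max (w ` {..<b z}))" if "i < b z" for i
      using that by (auto simp: less_Suc_eq_le)
    with w show "\<exists>W. \<forall>i<b z. \<exists>w<W. A (prod_encode (w, prod_encode (i, z)))"
      by blast
  qed (use P in blast)
  show ?thesis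
    unfolding semidecidable_def
    by (intro exI[of _ "\<lambda>u. \<forall>i<b (snd (prod_decode u)). \<exists>w<fst (prod_decode u).
        A (prod_encode (w, prod_encode (i, snd (prod_decode u))))"] conjI
        decidable_ball decidable_bex decidable_comp[OF A(1)] computable_prod_encode computable_comp[OF assms(1)]
        computable_fst computable_snd computable_id) (simp add: eq)
qed

lemma semidecidable_subst:
  assumes "semidecidable (\<lambda>u. P (fst (prod_decode u)) (snd (prod_decode u)))" "computable a" "computable b"
  shows "semidecidable (\<lambda>z. P (a z) (b z))"
  using semidecidable_comp[OF assms(1) computable_prod_encode[OF assms(2,3)]] by simp

lemmas computable_intros = computable_const computable_id computable_Suc computable_add computable_diff
  computable_prod_encode computable_fst computable_snd

lemmas decidable_intros = decidable_const decidable_not decidable_le decidable_less decidable_conj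
  decidable_disj decidable_imp decidable_eq decidable_ball decidable_bex

section \<open>Computing with coded lists\<close>

definition code_drop :: "nat \<Rightarrow> nat \<Rightarrow> nat" where
  "code_drop c i = list_encode (drop i (list_decode c))"

text \<open>A nonempty list is coded by the successor of the pair of its head and the code of its
  tail, hence the subtraction. Past the end the value is 0, so that access is a total computable
  function.\<close>

definition code_nth :: "nat \<Rightarrow> nat \<Rightarrow> nat" where
  "code_nth c i = fst (prod_decode (code_drop c i - 1))"

lemma code_drop_Suc: "code_drop c (Suc i) = snd (prod_decode (code_drop c i - 1))"
proof (cases "drop i (list_decode c)")
  \<comment> \<open>The empty list has code 0 and \<open>prod_decode 0\<close> is
    \<open>(0, 0)\<close>, so the iteration stays at 0 once the list is exhausted.\<close>
  case Nil
  then show ?thesis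
    by (simp add: code_drop_def prod_decode_def prod_decode_aux.simps)
next
  case (Cons x xs)
  then have "drop (Suc i) (list_decode c) = xs"
    by (metis drop_Suc drop_tl list.sel(3))
  with Cons show ?thesis
    by (simp add: code_drop_def)
qed

lemma code_nth: "i < length (list_decode c) \<Longrightarrow> code_nth c i = list_decode c ! i"
  by (simp add: code_nth_def code_drop_def Cons_nth_drop_Suc[symmetric])

lemma code_nth_list_encode: "i < length xs \<Longrightarrow> code_nth (list_encode xs) i = xs ! i"
  by (simp add: code_nth)

lemma computable_code_drop:
  assumes "computable c" "computable i"
  shows "computable (\<lambda>z. code_drop (c z) (i z))"
proof -
  have "computable (\<lambda>z. rec_nat (c z) (\<lambda>_ r. snd (prod_decode (r - 1))) (i z))"
    by (intro computable_rec_nat computable_intros assms)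
  moreover have "rec_nat m (\<lambda>_ r. snd (prod_decode (r - 1))) n = code_drop m n" for m n
    by (induction n) (simp_all add: code_drop_Suc, simp add: code_drop_def)
  ultimately show ?thesis
    by simp
qed

lemma computable_code_nth:
  assumes "computable c" "computable i"
  shows "computable (\<lambda>z. code_nth (c z) (i z))"
  unfolding code_nth_def by (intro computable_intros computable_code_drop assms)

lemma list_encode_eq_0_iff: "list_encode xs = 0 \<longleftrightarrow> xs = []"
  by (cases xs) auto

lemma computable_length:
  assumes "computable (\<lambda>z. list_encode (L z))"
  shows "computable (\<lambda>z. length (L z))"
proof -
  have "computable (\<lambda>c. LEAST i. code_drop c i = 0)"
  proof (rule computable_Least)
    show "decidable (\<lambda>u. code_drop (snd (prod_decode u)) (fst (prod_decode u)) = 0)"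
      by (intro computable_code_drop decidable_intros computable_intros)
    show "\<exists>i. code_drop c i = 0" for c
      by (auto simp: code_drop_def list_encode_eq_0_iff)
  qed
  then have "computable (\<lambda>z. LEAST i. code_drop (list_encode (L z)) i = 0)"
    using assms by (rule computable_comp)
  moreover have "(LEAST i. code_drop (list_encode xs) i = 0) = length xs" for xs
    by (auto simp: code_drop_def list_encode_eq_0_iff intro!: Least_equality)
  ultimately show ?thesis by simp
qed

lemma computable_Cons:
  "computable a \<Longrightarrow> computable (\<lambda>z. list_encode (L z)) \<Longrightarrow> computable (\<lambda>z. list_encode (a z # L z))"
  by (simp add: computable_intros)

lemma computable_tl:
  assumes "computable (\<lambda>z. list_encode (L z))"
  shows "computable (\<lambda>z. list_encode (tl (L z)))"
  using computable_code_drop[OF assms computable_const[of 1]] by (simp add: code_drop_def drop_Suc)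

lemma computable_list_decode:
  "computable c \<Longrightarrow> computable (\<lambda>z. list_encode (list_decode (c z)))"
  by simp

lemma Least_eq_iff:
  fixes P :: "nat \<Rightarrow> bool"
  assumes "\<exists>n. P n"
  shows "(LEAST n. P n) = n \<longleftrightarrow> P n \<and> (\<forall>m<n. \<not> P m)"
proof
  assume "(LEAST n. P n) = n"
  then show "P n \<and> (\<forall>m<n. \<not> P m)"
    using LeastI_ex[OF assms] not_less_Least[of _ P] by blast
next
  assume "P n \<and> (\<forall>m<n. \<not> P m)"
  then show "(LEAST n. P n) = n"
    by (intro Least_equality) (auto simp: not_less[symmetric])
qed

section \<open>Semidecidability of evaluation\<close>

lemma semidecidable_list_all2:
  assumes "\<And>t y. t \<in> set ts \<Longrightarrow> computable y \<Longrightarrow> semidecidable (\<lambda>z. Q t z (y z))"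
    and "computable (\<lambda>z. list_encode (L z))"
  shows "semidecidable (\<lambda>z. list_all2 (\<lambda>t. Q t z) ts (L z))"
  using assms
proof (induction ts arbitrary: L)
  case Nil
  have "decidable (\<lambda>z. list_encode (L z) = 0)"
    by (intro decidable_intros computable_intros Nil)
  then show ?case
    by (auto intro: semidecidable_decidable simp: list_encode_eq_0_iff)
next
  case (Cons t ts)
  have eq: "list_all2 (\<lambda>t. Q t z) (t # ts) xs \<longleftrightarrow>
      list_encode xs \<noteq> 0 \<and> Q t z (code_nth (list_encode xs) 0) \<and> list_all2 (\<lambda>t. Q t z) ts (tl xs)" for z xs
    by (cases xs) (auto simp: code_nth)
  show ?case
    unfolding eq
    by (intro semidecidable_conj semidecidable_decidable[of "\<lambda>z. list_encode (L z) \<noteq> 0"] Cons decidable_intros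
       computable_intros computable_code_nth computable_tl) auto
qed

text \<open>The number \<open>s\<close> codes the course of values of the recursion. This replaces
  the recursive evaluation rule by one existential quantifier in front of a bounded universal
  one.\<close>

lemma evals_PrimRec_iff:
  "evals (PrimRec f g) (n # xs) y \<longleftrightarrow> (\<exists>s. evals f xs (code_nth s 0) \<and>
     (\<forall>i<n. evals g (i # code_nth s i # xs) (code_nth s (Suc i))) \<and> y = code_nth s n)"
proof
  have "evals (PrimRec f g) (n # xs) y \<Longrightarrow> \<exists>ys. length ys = Suc n \<and> evals f xs (ys ! 0) \<and>
     (\<forall>i<n. evals g (i # ys ! i # xs) (ys ! Suc i)) \<and> y = ys ! n"
  proof (induction n arbitrary: y)
    case 0
    then show ?case
      by (intro exI[of _ "[y]"]) (auto simp: evals_PrimRec_0_iff)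
  next
    case (Suc n)
    then obtain r where r: "evals (PrimRec f g) (n # xs) r" "evals g (n # r # xs) y"
      by (auto simp: evals_PrimRec_Suc_iff)
    with Suc.IH obtain ys where "length ys = Suc n" "evals f xs (ys ! 0)"
      "\<forall>i<n. evals g (i # ys ! i # xs) (ys ! Suc i)" "r = ys ! n"
      by blast
    with r show ?case
      by (intro exI[of _ "ys @ [y]"]) (auto simp: nth_append less_Suc_eq)
  qed
  moreover assume "evals (PrimRec f g) (n # xs) y"
  ultimately obtain ys where "length ys = Suc n" "evals f xs (ys ! 0)"
     "\<forall>i<n. evals g (i # ys ! i # xs) (ys ! Suc i)" "y = ys ! n"
    by blast
  then show "\<exists>s. evals f xs (code_nth s 0) \<and>
     (\<forall>i<n. evals g (i # code_nth s i # xs) (code_nth s (Suc i))) \<and> y = code_nth s n"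
    by (intro exI[of _ "list_encode ys"]) (auto simp: code_nth_list_encode)
next
  assume "\<exists>s. evals f xs (code_nth s 0) \<and>
     (\<forall>i<n. evals g (i # code_nth s i # xs) (code_nth s (Suc i))) \<and> y = code_nth s n"
  then obtain s where s: "evals f xs (code_nth s 0)"
     "\<And>i. i < n \<Longrightarrow> evals g (i # code_nth s i # xs) (code_nth s (Suc i))" "y = code_nth s n"
    by blast
  have "k \<le> n \<Longrightarrow> evals (PrimRec f g) (k # xs) (code_nth s k)" for k
    by (induction k) (use s in \<open>auto simp: evals_PrimRec_0_iff evals_PrimRec_Suc_iff Suc_le_eq\<close>)
  with s show "evals (PrimRec f g) (n # xs) y"
    by simp
qed

text \<open>The term is fixed and only its arguments and value vary with \<open>z\<close>, so
  structural induction does the work of an interpreter: each constructor contributes connectives,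
  bounded quantifiers and existential quantifiers over codes.\<close>

lemma semidecidable_evals:
  assumes "computable (\<lambda>z. list_encode (L z))" "computable y"
  shows "semidecidable (\<lambda>z. evals t (L z) (y z))"
  using assms
proof (induction t arbitrary: L y)
  case Zero
  then show ?case
    unfolding evals_Zero_iff
    by (intro semidecidable_decidable decidable_intros computable_intros)
next
  case Succ
  have eq: "evals Succ xs y \<longleftrightarrow> length xs = 1 \<and> y = Suc (code_nth (list_encode xs) 0)" for xs y
    by (auto simp: evals_Succ_iff length_Suc_conv code_nth_list_encode simp del: list_encode.simps)
  show ?case
    unfolding eq
    by (intro semidecidable_decidable decidable_intros computable_intros computable_length
        computable_code_nth Succ)
next
  case (Proj i)
  have eq: "evals (Proj i) xs y \<longleftrightarrow> i < length xs \<and> y = code_nth (list_encode xs) i" for xs y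
    by (auto simp: evals_Proj_iff code_nth_list_encode)
  show ?case
    unfolding eq
    by (intro semidecidable_decidable decidable_intros computable_intros computable_length
        computable_code_nth Proj)
next
  case (Comp f gs)
  have eq: "evals (Comp f gs) xs y \<longleftrightarrow>
    (\<exists>c. list_all2 (\<lambda>g. evals g xs) gs (list_decode c) \<and> evals f (list_decode c) y)" for xs y
    unfolding evals_Comp_iff by (metis list_encode_inverse)
  show ?case
    unfolding eq
    by (intro semidecidable_ex semidecidable_conj semidecidable_list_all2 Comp(1) Comp(2)
        computable_list_decode computable_intros computable_snd_comp[OF Comp(3)]
        computable_snd_comp[OF Comp(4)])
next
  case (PrimRec f g)
  have eq: "evals (PrimRec f g) xs y \<longleftrightarrow> list_encode xs \<noteq> 0 \<and> (\<exists>s. evals f (tl xs) (code_nth s 0) \<and>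
     (\<forall>i<code_nth (list_encode xs) 0. evals g (i # code_nth s i # tl xs) (code_nth s (Suc i))) \<and>
       y = code_nth s (code_nth (list_encode xs) 0))" for xs y
    by (cases xs) (simp_all add: evals_PrimRec_Nil_iff evals_PrimRec_iff code_nth)
  show ?case
    unfolding eq
    by (intro semidecidable_ex semidecidable_conj semidecidable_decidable[of "\<lambda>z. list_encode (L z) \<noteq> 0"]
        semidecidable_decidable[of "\<lambda>z. p z = q z" for p q]
        semidecidable_ball decidable_intros PrimRec(1,2)
        computable_Cons computable_tl computable_intros computable_code_nth
        computable_snd_comp[OF PrimRec(3)] computable_snd_comp[OF computable_snd_comp[OF PrimRec(3)]]
        computable_snd_comp[OF PrimRec(4)] PrimRec(3))
next
  case (Mu f)
  show ?case
    unfolding evals_Mu_iff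
    by (intro semidecidable_ex semidecidable_conj semidecidable_ball Mu(1) computable_Cons computable_intros
       computable_snd_comp[OF Mu(2)] computable_snd_comp[OF computable_snd_comp[OF computable_snd_comp[OF Mu(2)]]]
       computable_snd_comp[OF computable_snd_comp[OF Mu(2)]] Mu(2,3))
qed

section \<open>Passing between relations on lists and predicates on numbers\<close>

lemma semidecidable_of_ce_rel:
  assumes "ce_rel k R" "computable (\<lambda>z. list_encode (L z))" "\<And>z. length (L z) = k"
  shows "semidecidable (\<lambda>z. R (L z))"
proof -
  obtain f where f: "partial_computable k f" "\<And>xs. length xs = k \<Longrightarrow> R xs \<longleftrightarrow> f xs \<noteq> None"
    using assms(1) by (auto simp: ce_rel_def)
  then obtain t where t: "\<And>xs y. length xs = k \<Longrightarrow> f xs = Some y \<longleftrightarrow> evals t xs y"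
    by (auto simp: partial_computable_def)
  have eq: "R (L z) \<longleftrightarrow> (\<exists>y. evals t (L z) y)" for z
    using f(2) t assms(3) by fastforce
  show ?thesis
    unfolding eq
    by (intro semidecidable_ex semidecidable_evals computable_intros computable_snd_comp assms(2))
qed

lemma decidable_of_computable_rel:
  assumes "computable_rel k R" "computable (\<lambda>z. list_encode (L z))" "\<And>z. length (L z) = k"
  shows "decidable (\<lambda>z. R (L z))"
proof -
  \<comment> \<open>The term for \<open>R\<close> acts on \<open>k\<close> separate arguments, so
    the list \<open>L z\<close> is rebuilt from its entries, each of which is a computable function
    of \<open>z\<close>.\<close>
  define Gs where "Gs = map (\<lambda>i xs. code_nth (list_encode (L (xs ! 0))) i) [0..<k]"
  have "total_computable (length Gs) (\<lambda>xs. if R xs then 1 else 0)"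
    using assms(1) by (simp add: Gs_def computable_rel_def)
  moreover have "total_computable 1 G" if G: "G \<in> set Gs" for G
  proof -
    obtain i where "G = (\<lambda>xs. code_nth (list_encode (L (xs ! 0))) i)"
      using G by (auto simp: Gs_def)
    then show ?thesis
      using computable_code_nth[OF assms(2) computable_const[of i]] by (simp add: computable_def)
  qed
  ultimately have "total_computable 1 (\<lambda>xs. if R (map (\<lambda>G. G xs) Gs) then 1 else 0)"
    by (rule total_computable_Comp)
  moreover have "map (\<lambda>G. G xs) Gs = L (xs ! 0)" for xs
    by (auto simp: Gs_def list_eq_iff_nth_eq assms(3) code_nth_list_encode)
  ultimately show ?thesis
    by (simp add: decidable_def computable_def)
qed

text \<open>The unbounded search for the least witness halts exactly where the predicate
  holds.\<close>

lemma ce_rel_of_semidecidable: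
  assumes "semidecidable P"
  shows "ce_rel 2 (\<lambda>xs. P (prod_encode (xs ! 0, xs ! 1)))"
proof -
  obtain A where A: "decidable A" "\<And>z. P z \<longleftrightarrow> (\<exists>w. A (prod_encode (w, z)))"
    using assms by (auto simp: semidecidable_def)
  have "total_computable (Suc 2) (\<lambda>xs. if \<not> A (prod_encode (xs ! 0, prod_encode (xs ! 1, xs ! 2))) then 1 else 0)"
    using decidable_not[OF A(1), unfolded decidable_def]
    by (rule total_computable_arg) (intro total_computable_prod_encode total_computable_Proj; simp)+
  from evals_Mu_total[OF this] obtain t where t: "\<forall>xs n. length xs = 2 \<longrightarrow> (evals t xs n \<longleftrightarrow>
     (if \<not> A (prod_encode ((n # xs) ! 0, prod_encode ((n # xs) ! 1, (n # xs) ! 2))) then 1 else 0) = (0::nat) \<and>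
     (\<forall>m<n. (if \<not> A (prod_encode ((m # xs) ! 0, prod_encode ((m # xs) ! 1, (m # xs) ! 2))) then 1 else 0) \<noteq> (0::nat)))" ..
  have t: "length xs = 2 \<Longrightarrow> evals t xs n \<longleftrightarrow> A (prod_encode (n, prod_encode (xs ! 0, xs ! 1))) \<and>
     (\<forall>m<n. \<not> A (prod_encode (m, prod_encode (xs ! 0, xs ! 1))))" for xs n
    by (simp add: t) blast
  define f where "f xs = (if P (prod_encode (xs ! 0, xs ! 1))
    then Some (LEAST w. A (prod_encode (w, prod_encode (xs ! 0, xs ! 1)))) else None)" for xs :: "nat list"
  have "f xs = Some n \<longleftrightarrow> evals t xs n" if "length xs = 2" for xs n
  proof (cases "P (prod_encode (xs ! 0, xs ! 1))")
    case True
    then have "\<exists>w. A (prod_encode (w, prod_encode (xs ! 0, xs ! 1)))"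
      by (simp add: A(2))
    from Least_eq_iff[OF this] True show ?thesis
      by (simp add: t[OF that] f_def)
  next
    case False
    then show ?thesis
      by (simp add: t[OF that] f_def A(2))
  qed
  then have "partial_computable 2 f"
    unfolding partial_computable_def by blast
  then show ?thesis
    unfolding ce_rel_def by (intro exI[of _ f]) (auto simp: f_def)
qed

text \<open>The s-m-n property for semidecidable predicates. It supplies the reduction, the
  conjectures of the learner and the index of a given machine.\<close>

lemma standard_numbering_index:
  assumes "standard_numbering W" "semidecidable P"
  shows "\<exists>h. computable h \<and> (\<forall>e. W (h e) = {x. P (prod_encode (e, x))})"
proof -
  have "\<forall>R. ce_rel 2 R \<longrightarrow> (\<exists>h. computable h \<and> (\<forall>e. W (h e) = {x. R [e, x]}))"
    using assms(1) by (simp add: standard_numbering_def)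
  from this[rule_format, OF ce_rel_of_semidecidable[OF assms(2)]]
  show ?thesis
    by simp
qed

lemma standard_numbering_semidecidable:
  assumes "standard_numbering W" "computable a" "computable b"
  shows "semidecidable (\<lambda>z. a z \<in> W (b z))"
proof -
  have "ce_rel 2 (\<lambda>xs. xs ! 1 \<in> W (xs ! 0))"
    using assms(1) by (simp add: standard_numbering_def)
  from semidecidable_of_ce_rel[OF this, of "\<lambda>z. [b z, a z]"] assms(2,3) show ?thesis
    by (simp add: computable_intros)
qed

section \<open>Reducing \<open>\<Sigma>\<^sub>5\<close> predicates to cofiniteness\<close>

lemma sigma_pred_5_normal_form:
  assumes "sigma_pred 5 P"
  obtains Q :: "nat \<Rightarrow> nat \<Rightarrow> nat \<Rightarrow> nat \<Rightarrow> nat \<Rightarrow> nat \<Rightarrow> bool" where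
    "\<And>e. P e \<longleftrightarrow> (\<exists>a. \<forall>b. \<exists>c. \<forall>d. \<exists>z. Q e a b c d z)"
    "\<And>e a b c d z. computable e \<Longrightarrow> computable a \<Longrightarrow> computable b \<Longrightarrow> computable c \<Longrightarrow> computable d \<Longrightarrow>
      computable z \<Longrightarrow> decidable (\<lambda>u. Q (e u) (a u) (b u) (c u) (d u) (z u))"
proof -
  have "sigma_rel (Suc (Suc (Suc (Suc (Suc 0))))) 1 (\<lambda>xs. P (xs ! 0))"
    using assms by (simp add: sigma_pred_def eval_nat_numeral)
  then obtain S1 S2 S3 S4 R where
    1: "\<forall>xs. length xs = 1 \<longrightarrow> (P (xs ! 0) \<longleftrightarrow> (\<exists>y. S1 (y # xs)))" and
    2: "\<forall>xs. length xs = Suc 1 \<longrightarrow> (S1 xs \<longleftrightarrow> (\<forall>y. S2 (y # xs)))" and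
    3: "\<forall>xs. length xs = Suc (Suc 1) \<longrightarrow> (S2 xs \<longleftrightarrow> (\<exists>y. S3 (y # xs)))" and
    4: "\<forall>xs. length xs = Suc (Suc (Suc 1)) \<longrightarrow> (S3 xs \<longleftrightarrow> (\<forall>y. S4 (y # xs)))" and
    5: "\<forall>xs. length xs = Suc (Suc (Suc (Suc 1))) \<longrightarrow> (S4 xs \<longleftrightarrow> (\<exists>y. R (y # xs)))" and
    R: "computable_rel (Suc (Suc (Suc (Suc (Suc 1))))) R"
    unfolding sigma_rel.simps pi_rel.simps by (elim exE conjE) (rule that)
  show ?thesis
  \<comment> \<open>Each quantifier of the hierarchy puts its variable at the front, so the
    innermost variable heads the list.\<close>
  proof (rule that[of "\<lambda>e a b c d z. R [z, d, c, b, a, e]"])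
    show "P e \<longleftrightarrow> (\<exists>a. \<forall>b. \<exists>c. \<forall>d. \<exists>z. R [z, d, c, b, a, e])" for e
      using 1[rule_format, of "[e]"] by (simp add: 2 3 4 5)
    show "decidable (\<lambda>u. R [z u, d u, c u, b u, a u, e u])"
      if "computable e" "computable a" "computable b" "computable c" "computable d" "computable z"
      for e a b c d z
      by (rule decidable_of_computable_rel[OF R]) (use that in \<open>auto intro!: computable_intros\<close>)
  qed
qed

text \<open>The complement of \<open>V p\<close> consists of the lists whose \<open>i\<close>-th entry is the witness that
  \<open>\<forall>d. \<exists>z. Q p i d z\<close> fails. Making that witness unique leaves at most one list of each length.\<close>

lemma cofinite_sigma3:
  fixes Q :: "nat \<Rightarrow> nat \<Rightarrow> nat \<Rightarrow> nat \<Rightarrow> bool"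
  assumes Q: "\<And>p i d z. computable p \<Longrightarrow> computable i \<Longrightarrow> computable d \<Longrightarrow> computable z \<Longrightarrow>
      decidable (\<lambda>u. Q (p u) (i u) (d u) (z u))"
  obtains V :: "nat \<Rightarrow> nat set" where
    "semidecidable (\<lambda>u. fst (prod_decode u) \<in> V (snd (prod_decode u)))"
    "\<And>p. finite (- V p) \<longleftrightarrow> (\<exists>i. \<forall>d. \<exists>z. Q p i d z)"
proof -
  \<comment> \<open>Here \<open>u\<close> codes a pair of d and w: \<open>wit\<close> says that w is
    the least bound for finding a z for every number below d, and \<open>good\<close> adds that d
    itself has no z. Thus d is the least failure and w is determined by it; \<open>wit\<close> is
    decidable, only the failure at d is not.\<close>
  define wit where "wit p i u \<longleftrightarrow> (\<forall>d<fst (prod_decode u). \<exists>z<Suc (snd (prod_decode u)). Q p i d z) \<and>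
    (\<forall>w<snd (prod_decode u). \<exists>d<fst (prod_decode u). \<forall>z<Suc w. \<not> Q p i d z)" for p i u
  define good where "good p i u \<longleftrightarrow> wit p i u \<and> (\<forall>z. \<not> Q p i (fst (prod_decode u)) z)" for p i u
  have wit: "decidable (\<lambda>z. wit (p z) (i z) (u z))" if "computable p" "computable i" "computable u" for p i u
    unfolding wit_def
    by (intro decidable_intros Q computable_intros that[THEN computable_comp])
  have good_unique: "u = v" if u: "good p i u" and v: "good p i v" for p i u v
  proof -
    obtain d w d' w' where uv: "u = prod_encode (d, w)" "v = prod_encode (d', w')"
      by (metis prod_decode_inverse surj_pair)
    have "d = d'"
      using u v unfolding good_def wit_def uv by (metis fst_conv linorder_neqE_nat prod_encode_inverse)
    moreover from this have "w = w'"
      using u v unfolding good_def wit_def uv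
      by (metis (no_types, lifting) fst_conv snd_conv linorder_neqE_nat prod_encode_inverse)
    ultimately show ?thesis
      by (simp add: uv)
  qed
  have good_ex: "\<exists>u. good p i u" if "\<exists>d. \<forall>z. \<not> Q p i d z" for p i
  proof -
    define d where "d = (LEAST d. \<forall>z. \<not> Q p i d z)"
    have d: "\<forall>z. \<not> Q p i d z"
      unfolding d_def by (rule LeastI_ex[OF that])
    have "\<exists>z. Q p i d' z" if "d' < d" for d'
      using not_less_Least[OF that[unfolded d_def]] by blast
    then obtain f where f: "\<And>d'. d' < d \<Longrightarrow> Q p i d' (f d')"
      by metis
    let ?B = "\<lambda>w. \<forall>d'<d. \<exists>z<Suc w. Q p i d' z"
    \<comment> \<open>The maximum of the chosen values is one bound; the unique witness needs the
      least one.\<close>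
    have "?B (Max (f ` {..<d}))"
      using f by (auto intro!: exI[of _ "f _"] simp: less_Suc_eq_le)
    then have "?B (LEAST w. ?B w)"
      by (rule LeastI)
    then have "good p i (prod_encode (d, LEAST w. ?B w))"
      unfolding good_def wit_def using d by (auto dest: not_less_Least)
    then show ?thesis ..
  qed
  define V where "V p = {n. \<exists>i<length (list_decode n). \<not> good p i (list_decode n ! i)}" for p
  have notin_V: "n \<notin> V p \<longleftrightarrow> (\<forall>i<length (list_decode n). good p i (list_decode n ! i))" for n p
    by (simp add: V_def)
  \<comment> \<open>The only unbounded quantifier in \<open>good\<close> is universal, so its
    negation is a search for \<open>z\<close>.\<close>
  have in_V: "n \<in> V p \<longleftrightarrow> (\<exists>z. \<exists>i<length (list_decode n). wit p i (code_nth n i) \<longrightarrow>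
      Q p i (fst (prod_decode (code_nth n i))) z)" for n p
  proof -
    have "\<not> good p i (list_decode n ! i) \<longleftrightarrow>
        (\<exists>z. wit p i (code_nth n i) \<longrightarrow> Q p i (fst (prod_decode (code_nth n i))) z)"
      if "i < length (list_decode n)" for i
      by (simp add: good_def code_nth that)
    then show ?thesis
      unfolding V_def by blast
  qed
  show ?thesis
  proof (rule that[of V])
    show "semidecidable (\<lambda>u. fst (prod_decode u) \<in> V (snd (prod_decode u)))"
      unfolding in_V
      by (intro semidecidable_ex semidecidable_decidable decidable_intros wit Q computable_intros
          computable_length computable_list_decode computable_code_nth)
  next
    fix p
    show "finite (- V p) \<longleftrightarrow> (\<exists>i. \<forall>d. \<exists>z. Q p i d z)"
    proof
      assume "finite (- V p)"
      show "\<exists>i. \<forall>d. \<exists>z. Q p i d z"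
      proof (rule ccontr)
        assume "\<not> ?thesis"
        then obtain u where u: "\<And>i. good p i (u i)"
          using good_ex by metis
        \<comment> \<open>If every \<open>i\<close> fails, the initial segments of the sequence of
          witnesses all lie in the complement, which is therefore infinite.\<close>
        have "list_encode (map u [0..<k]) \<in> - V p" for k
          by (simp add: notin_V u)
        then have "range (\<lambda>k. list_encode (map u [0..<k])) \<subseteq> - V p"
          by blast
        moreover have "inj (\<lambda>k. list_encode (map u [0..<k]))"
          by (rule injI) (metis list_encode_inverse length_map length_upt minus_nat.diff_0)
        ultimately show False
          using \<open>finite (- V p)\<close> finite_subset finite_imageD infinite_UNIV_nat by blast
      qed
    next
      assume "\<exists>i. \<forall>d. \<exists>z. Q p i d z"
      then obtain i where i: "\<And>d. \<exists>z. Q p i d z" by blast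
      \<comment> \<open>Nothing is good at a successful \<open>i\<close>, so no list in the
        complement reaches beyond that position.\<close>
      have "length (list_decode n) \<le> i" if "n \<in> - V p" for n
        using that i notin_V[of n p] unfolding good_def by (metis ComplD not_le)
      then have "(\<lambda>n. length (list_decode n)) ` (- V p) \<subseteq> {..i}"
        by auto
      moreover have "inj_on (\<lambda>n. length (list_decode n)) (- V p)"
      proof (rule inj_onI)
        fix m n
        assume "m \<in> - V p" "n \<in> - V p" "length (list_decode m) = length (list_decode n)"
        then have "list_decode m = list_decode n"
          using good_unique by (auto simp: notin_V list_eq_iff_nth_eq)
        then show "m = n"
          by (metis list_decode_inverse)
      qed
      ultimately show "finite (- V p)"
        by (metis finite_atMost finite_imageD finite_subset)
    qed
  qed
qed

text \<open>Bounding the outermost witness by \<open>x\<close> makes the good \<open>x\<close> cofinal; the exchange of this bounded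
  quantifier with the universal one turns \<open>y\<close> into a code of one challenge for every \<open>a \<le> x\<close>.\<close>

lemma sigma5_cofinite_form:
  assumes "sigma_pred 5 P"
  obtains V :: "nat \<Rightarrow> nat set" where
    "semidecidable (\<lambda>u. fst (prod_decode u) \<in> V (snd (prod_decode u)))"
    "\<And>e. P e \<Longrightarrow> \<exists>x0. \<forall>x\<ge>x0. \<forall>y. finite (- V (prod_encode (e, prod_encode (x, y))))"
    "\<And>e x. \<not> P e \<Longrightarrow> \<exists>y. infinite (- V (prod_encode (e, prod_encode (x, y))))"
proof -
  obtain Q :: "nat \<Rightarrow> nat \<Rightarrow> nat \<Rightarrow> nat \<Rightarrow> nat \<Rightarrow> nat \<Rightarrow> bool" where
    P: "\<And>e. P e \<longleftrightarrow> (\<exists>a. \<forall>b. \<exists>c. \<forall>d. \<exists>z. Q e a b c d z)" and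
    Q: "\<And>e a b c d z. computable e \<Longrightarrow> computable a \<Longrightarrow> computable b \<Longrightarrow> computable c \<Longrightarrow> computable d \<Longrightarrow>
      computable z \<Longrightarrow> decidable (\<lambda>u. Q (e u) (a u) (b u) (c u) (d u) (z u))"
    by (rule sigma_pred_5_normal_form[OF assms]) blast
  \<comment> \<open>Here \<open>p\<close> codes e, x and y, and \<open>i\<close> codes the pair of c
    and a. The challenge for a is the entry of y at position a.\<close>
  define Q' where "Q' p i d z \<longleftrightarrow> snd (prod_decode i) \<le> fst (prod_decode (snd (prod_decode p))) \<and>
    Q (fst (prod_decode p)) (snd (prod_decode i))
      (code_nth (snd (prod_decode (snd (prod_decode p)))) (snd (prod_decode i))) (fst (prod_decode i)) d z"
    for p i d z
  have Q': "decidable (\<lambda>u. Q' (p u) (i u) (d u) (z u))"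
    if "computable p" "computable i" "computable d" "computable z" for p i d z
    unfolding Q'_def by (intro decidable_intros Q computable_intros computable_code_nth that)
  obtain V where
    V: "semidecidable (\<lambda>u. fst (prod_decode u) \<in> V (snd (prod_decode u)))"
      "\<And>p. finite (- V p) \<longleftrightarrow> (\<exists>i. \<forall>d. \<exists>z. Q' p i d z)"
    by (rule cofinite_sigma3[of Q']) ((rule Q'; assumption), rule that)
  have fin: "finite (- V (prod_encode (e, prod_encode (x, y)))) \<longleftrightarrow>
      (\<exists>a\<le>x. \<exists>c. \<forall>d. \<exists>z. Q e a (code_nth y a) c d z)" for e x y
  proof
    assume "finite (- V (prod_encode (e, prod_encode (x, y))))"
    then show "\<exists>a\<le>x. \<exists>c. \<forall>d. \<exists>z. Q e a (code_nth y a) c d z"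
      by (auto simp: V(2) Q'_def)
  next
    assume "\<exists>a\<le>x. \<exists>c. \<forall>d. \<exists>z. Q e a (code_nth y a) c d z"
    then obtain a c where "a \<le> x" "\<forall>d. \<exists>z. Q e a (code_nth y a) c d z" by blast
    then have "Q' (prod_encode (e, prod_encode (x, y))) (prod_encode (c, a)) d z \<longleftrightarrow>
        Q e a (code_nth y a) c d z" for d z
      by (simp add: Q'_def)
    with \<open>\<forall>d. \<exists>z. _ d z\<close> show "finite (- V (prod_encode (e, prod_encode (x, y))))"
      unfolding V(2) by blast
  qed
  show ?thesis
  proof (rule that[OF V(1)])
    \<comment> \<open>Any witness a of \<open>P e\<close> serves as \<open>x0\<close>: once x is at
      least a, it answers every challenge y.\<close>
    show "\<exists>x0. \<forall>x\<ge>x0. \<forall>y. finite (- V (prod_encode (e, prod_encode (x, y))))" if "P e" for e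
      using that unfolding P fin by blast
    show "\<exists>y. infinite (- V (prod_encode (e, prod_encode (x, y))))" if "\<not> P e" for e x
    proof -
      have "\<forall>a. \<exists>b. \<not> (\<exists>c. \<forall>d. \<exists>z. Q e a b c d z)"
        using that unfolding P by blast
      then obtain b where "\<And>a. \<not> (\<exists>c. \<forall>d. \<exists>z. Q e a (b a) c d z)"
        by metis
      \<comment> \<open>The code of \<open>b 0\<close>, ..., \<open>b x\<close> defeats all
        candidates up to \<open>x\<close> at once.\<close>
      then have "\<not> (\<exists>a\<le>x. \<exists>c. \<forall>d. \<exists>z. Q e a (code_nth (list_encode (map b [0..<Suc x])) a) c d z)"
        by (auto simp: code_nth_list_encode less_Suc_eq_le simp del: upt_Suc list_encode.simps)
      then show ?thesis
        unfolding fin by blast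
    qed
  qed
qed

section \<open>Learning and failing to learn\<close>

text \<open>Codes serve as size bounds: they limit the search of the learner, and they put the
  entries of a certificate below the bound that it raises.\<close>

lemma elem_less_list_encode: "v \<in> set l \<Longrightarrow> v < list_encode l"
proof (induction l)
  case (Cons a l)
  have "a \<le> prod_encode (a, list_encode l)" "list_encode l \<le> prod_encode (a, list_encode l)"
    by (rule le_prod_encode_1 le_prod_encode_2)+
  with Cons show ?case
    by auto
qed simp

section \<open>Texts and their initial segments\<close>

lemma length_initial_segment [simp]: "length (initial_segment f i) = i"
  by (simp add: initial_segment_def)

lemma nth_initial_segment [simp]: "k < i \<Longrightarrow> initial_segment f i ! k = f k"
  by (simp add: initial_segment_def)

lemma set_initial_segment: "set (initial_segment f i) = f ` {..<i}"
  by (auto simp: initial_segment_def)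

lemma prefix_iff_nth: "prefix xs ys \<longleftrightarrow> length xs \<le> length ys \<and> (\<forall>i<length xs. xs ! i = ys ! i)"
  by (auto simp: prefix_def nth_append list_eq_iff_nth_eq intro!: exI[of _ "drop (length xs) ys"])

lemma prefix_initial_segment: "i \<le> j \<Longrightarrow> prefix (initial_segment f i) (initial_segment f j)"
  by (simp add: prefix_iff_nth)

lemma prefix_of_initial_segment:
  "prefix r (initial_segment f j) \<Longrightarrow> r = initial_segment f (length r)"
  by (auto simp: prefix_iff_nth list_eq_iff_nth_eq)

lemma enumeration_extending:
  assumes "A \<noteq> {}" "set s \<subseteq> A"
  obtains f where "enumeration_of f A" "initial_segment f (length s) = s"
proof -
  obtain a where a: "a \<in> A" using assms(1) by blast
  \<comment> \<open>After \<open>s\<close>, each \<open>v\<close> in \<open>A\<close> is listed at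
    position \<open>length s + v\<close>, and the remaining positions repeat \<open>a\<close>. Texts
    may be noncomputable, so membership in \<open>A\<close> may be tested freely.\<close>
  define f where "f n = (if n < length s then s ! n else if n - length s \<in> A then n - length s else a)" for n
  have "v \<in> range f" if "v \<in> A" for v
    using that by (intro image_eqI[of _ _ "length s + v"]) (auto simp: f_def)
  moreover have "f n \<in> A" for n
    using a assms(2) by (auto simp: f_def)
  ultimately have "range f = A"
    by auto
  moreover have "initial_segment f (length s) = s"
    by (auto simp: list_eq_iff_nth_eq f_def)
  ultimately show ?thesis
    by (intro that) (auto simp: enumeration_of_def)
qed

lemma eq_star_image:
  assumes "A =\<^sup>* B"
  shows "h ` A =\<^sup>* h ` B"
proof -
  have "sym_diff (h ` A) (h ` B) \<subseteq> h ` sym_diff A B"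
    by auto
  then show ?thesis
    using assms unfolding eq_star_def by (meson finite_imageI finite_subset)
qed

text \<open>The learner takes the tag from the first datum and conjectures the column whose number
  is the distance from \<open>\<beta> x\<close> to the least datum at or above it. The conjecture is
  constant once that element has appeared, and the last assumption makes it correct up to finitely
  many elements.\<close>

lemma learnable_by_least_element:
  fixes Z :: "nat \<Rightarrow> nat \<Rightarrow> nat set"
  assumes g: "computable g" "\<And>x j. W (g (prod_encode (x, j))) = (\<lambda>m. prod_encode (x, m)) ` Z x j"
    and \<beta>: "computable \<beta>" "\<And>x j. \<exists>k. \<beta> x + k \<in> Z x j"
    and Z: "\<And>x j. Z x (LEAST k. \<beta> x + k \<in> Z x j) =\<^sup>* Z x j"
  shows "txtex_star_learnable W (range (\<lambda>i.
    (\<lambda>m. prod_encode (fst (prod_decode i), m)) ` Z (fst (prod_decode i)) (snd (prod_decode i))))"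
proof -
  define X where "X c = fst (prod_decode (code_nth c 0))" for c
  \<comment> \<open>The alternative \<open>c \<le> k\<close> makes the search end on every input. It
    does not interfere in the limit: once the decisive datum is present, its distance is below the
    code of the string.\<close>
  define K where "K c = (LEAST k. (\<exists>i<length (list_decode c).
      code_nth c i = prod_encode (X c, \<beta> (X c) + k)) \<or> c \<le> k)" for c
  define M where "M l = Some (g (prod_encode (X (list_encode l), K (list_encode l))))" for l
  have X: "computable (\<lambda>z. X (c z))" if "computable c" for c
    unfolding X_def by (intro computable_intros computable_code_nth that)
  have "computable K"
    unfolding K_def
  proof (rule computable_Least)
    show "decidable (\<lambda>u. (\<exists>i<length (list_decode (snd (prod_decode u))).
        code_nth (snd (prod_decode u)) i = prod_encode (X (snd (prod_decode u)),
          \<beta> (X (snd (prod_decode u))) + fst (prod_decode u))) \<or> snd (prod_decode u) \<le> fst (prod_decode u))"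
      by (intro decidable_intros computable_intros X computable_code_nth computable_comp[OF \<beta>(1)]
          computable_length computable_list_decode)
  qed blast
  then have "computable (\<lambda>c. g (prod_encode (X c, K c)))"
    by (intro computable_comp[OF g(1)] computable_intros X)
  then have "learning_machine M"
    by (simp add: learning_machine_def M_def computable_def)
  moreover have "txtex_star_identifies W M f" if f: "range f = (\<lambda>m. prod_encode (x, m)) ` Z x j" for f x j
  proof -
    define k0 where "k0 = (LEAST k. \<beta> x + k \<in> Z x j)"
    have "\<beta> x + k0 \<in> Z x j"
      unfolding k0_def by (rule LeastI_ex[OF \<beta>(2)])
    then obtain n0 where n0: "f n0 = prod_encode (x, \<beta> x + k0)"
      using f by (metis imageE imageI)
    have conv: "M (initial_segment f i) = Some (g (prod_encode (x, k0)))" if "n0 < i" for i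
    proof -
      let ?l = "initial_segment f i"
      have nth: "code_nth (list_encode ?l) k = f k" if "k < i" for k
        using that by (simp add: code_nth_list_encode)
      have "f 0 \<in> (\<lambda>m. prod_encode (x, m)) ` Z x j"
        using f by blast
      then have X: "X (list_encode ?l) = x"
        using \<open>n0 < i\<close> nth[of 0] by (auto simp: X_def)
      have "f n0 \<in> set ?l"
        using \<open>n0 < i\<close> by (auto simp: set_initial_segment)
      then have "k0 < list_encode ?l"
        using elem_less_list_encode[of "f n0" ?l] le_prod_encode_2[of "\<beta> x + k0" x] by (simp add: n0)
      have "K (list_encode ?l) = k0"
        unfolding K_def X
      proof (rule Least_equality)
        show "(\<exists>k<length (list_decode (list_encode ?l)). code_nth (list_encode ?l) k =
            prod_encode (x, \<beta> x + k0)) \<or> list_encode ?l \<le> k0"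
          using n0 nth \<open>n0 < i\<close> by auto
      next
        fix k
        assume "(\<exists>k'<length (list_decode (list_encode ?l)). code_nth (list_encode ?l) k' =
            prod_encode (x, \<beta> x + k)) \<or> list_encode ?l \<le> k"
        then show "k0 \<le> k"
        proof
          assume "list_encode ?l \<le> k"
          then show ?thesis using \<open>k0 < list_encode ?l\<close> by simp
        next
          assume "\<exists>k'<length (list_decode (list_encode ?l)). code_nth (list_encode ?l) k' =
            prod_encode (x, \<beta> x + k)"
          then have "prod_encode (x, \<beta> x + k) \<in> range f"
            using nth by auto (metis rangeI)
          then have "\<beta> x + k \<in> Z x j"
            using f by auto
          then show ?thesis
            unfolding k0_def by (rule Least_le)
        qed
      qed
      with X show ?thesis
        by (simp add: M_def)
    qed
    have "W (g (prod_encode (x, k0))) =\<^sup>* range f"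
      unfolding g f k0_def by (rule eq_star_image[OF Z])
    with conv show ?thesis
      unfolding txtex_star_identifies_def by (meson Suc_le_eq)
  qed
  ultimately show ?thesis
    unfolding txtex_star_learnable_def txtex_star_learns_family_def txtex_star_learns_set_def
      enumeration_of_def by blast
qed

text \<open>The text for the set \<open>Z\<close> is followed until the machine has settled, then continued to a text for
  the full column, on which a stuck machine keeps its conjecture.\<close>

lemma stuck_machine_fails:
  assumes learns: "txtex_star_learns_set W M (range (\<lambda>m. prod_encode (x, m)))"
      "txtex_star_learns_set W M ((\<lambda>m. prod_encode (x, m)) ` Z)"
    and Z: "Z \<noteq> {}" "set s \<subseteq> (\<lambda>m. prod_encode (x, m)) ` Z"
    and stuck: "\<And>r c n n'. \<lbrakk>prefix s r; prefix r c; set c \<subseteq> range (\<lambda>m. prod_encode (x, m));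
      \<forall>m<b. prod_encode (x, m) \<in> set c; M r = Some n; M c = Some n'\<rbrakk> \<Longrightarrow> n = n'"
  shows "finite (- Z)"
proof -
  obtain f where f: "enumeration_of f ((\<lambda>m. prod_encode (x, m)) ` Z)" "initial_segment f (length s) = s"
    using enumeration_extending[OF _ Z(2)] Z(1) by blast
  then obtain n N where n: "\<And>i. N \<le> i \<Longrightarrow> M (initial_segment f i) = Some n"
      "W n =\<^sup>* (\<lambda>m. prod_encode (x, m)) ` Z"
    using learns(2) unfolding txtex_star_learns_set_def txtex_star_identifies_def enumeration_of_def
    by metis
  define r where "r = initial_segment f (max N (length s))"
  have "set r \<subseteq> (\<lambda>m. prod_encode (x, m)) ` Z"
    using f(1) by (auto simp: r_def set_initial_segment enumeration_of_def)
  then have r: "set r \<subseteq> range (\<lambda>m. prod_encode (x, m))"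
    by blast
  obtain f' where f': "enumeration_of f' (range (\<lambda>m. prod_encode (x, m)))" "initial_segment f' (length r) = r"
    using enumeration_extending[OF _ r] by blast
  then obtain n' N' where n': "\<And>i. N' \<le> i \<Longrightarrow> M (initial_segment f' i) = Some n'"
      "W n' =\<^sup>* range (\<lambda>m. prod_encode (x, m))"
    using learns(1) unfolding txtex_star_learns_set_def txtex_star_identifies_def enumeration_of_def
    by metis
  have "\<forall>m. \<exists>k. f' k = prod_encode (x, m)"
    using f'(1) unfolding enumeration_of_def by (metis rangeE rangeI)
  then obtain k where k: "\<And>m. f' (k m) = prod_encode (x, m)"
    by metis
  \<comment> \<open>Long enough for the machine to have settled on \<open>f'\<close>, for
    \<open>r\<close> to be an initial part, and for all tagged numbers below \<open>b\<close> to
    have appeared.\<close>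
  define I where "I = N' + length r + Suc (Max (k ` {..<b}))"
  define c where "c = initial_segment f' I"
  have "n = n'"
  proof (rule stuck)
    show "prefix s r"
      using prefix_initial_segment[of "length s" "max N (length s)" f] f(2) by (simp add: r_def)
    show "prefix r c"
      using prefix_initial_segment[of "length r" I f'] f'(2) by (simp add: c_def I_def)
    show "set c \<subseteq> range (\<lambda>m. prod_encode (x, m))"
      using f'(1) by (auto simp: c_def set_initial_segment enumeration_of_def)
    show "\<forall>m<b. prod_encode (x, m) \<in> set c"
    proof (intro allI impI)
      fix m assume "m < b"
      then have "k m < I"
        by (auto simp: I_def less_Suc_eq_le intro!: trans_le_add2)
      then show "prod_encode (x, m) \<in> set c"
        using k[of m] by (auto simp: c_def set_initial_segment intro!: image_eqI[of _ _ "k m"])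
    qed
    show "M r = Some n" "M c = Some n'"
      using n n' by (auto simp: r_def c_def I_def)
  qed
  \<comment> \<open>One conjecture approximates both the column and the full part, so these differ
    finitely; injectivity of tagging transfers this to \<open>Z\<close>.\<close>
  have "(\<lambda>m. prod_encode (x, m)) ` (- Z) \<subseteq>
    sym_diff (W n) ((\<lambda>m. prod_encode (x, m)) ` Z) \<union> sym_diff (W n') (range (\<lambda>m. prod_encode (x, m)))"
    using \<open>n = n'\<close> by auto
  then have "finite ((\<lambda>m. prod_encode (x, m)) ` (- Z))"
    using n(2) n'(2) unfolding eq_star_def by (meson finite_UnI finite_subset)
  then show ?thesis
    by (rule finite_imageD) (simp add: inj_on_def)
qed

text \<open>The strings converge to a text for their union. Arbitrarily late, two of its initial
  segments receive different conjectures, so there is no limit.\<close>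

lemma unstable_machine_fails:
  assumes chain: "\<And>t. prefix (s t) (s (Suc t))"
    and unstable: "\<And>T. \<exists>t\<ge>T. \<exists>r n n'. prefix (s t) r \<and> prefix r (s (Suc t)) \<and> n \<noteq> n' \<and> M r = Some n \<and>
      M (s (Suc t)) = Some n'"
  shows "\<not> txtex_star_learns_set W M (\<Union>t. set (s t))"
proof
  assume learns: "txtex_star_learns_set W M (\<Union>t. set (s t))"
  have mono: "prefix (s t) (s t')" if "t \<le> t'" for t t'
    using that by (induction rule: dec_induct) (auto intro: chain prefix_order.trans)
  \<comment> \<open>Different conjectures force \<open>r\<close> to be a proper prefix, so every
    unstable step lengthens the string.\<close>
  have long: "\<exists>t\<ge>T. k \<le> length (s t)" for k T
  proof (induction k)
    case (Suc k)
    then obtain t where t: "t \<ge> T" "k \<le> length (s t)" by blast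
    obtain t' r n n' where t': "t' \<ge> t" "prefix (s t') r" "prefix r (s (Suc t'))" "n \<noteq> n'" "M r = Some n"
      "M (s (Suc t')) = Some n'"
      using unstable[of t] by blast
    then have "r \<noteq> s (Suc t')"
      by auto
    with t'(3) have "length r < length (s (Suc t'))"
      by (intro prefix_length_less) (simp add: strict_prefix_def)
    with prefix_length_le[OF mono[OF t'(1)]] prefix_length_le[OF t'(2)]
    have "length (s t) < length (s (Suc t'))"
      by simp
    with t t'(1) show ?case
      by (intro exI[of _ "Suc t'"]) auto
  qed auto
  then have "\<forall>n. \<exists>t. Suc n \<le> length (s t)"
    by blast
  from choice[OF this] obtain T where T: "\<And>n. Suc n \<le> length (s (T n))"
    by blast
  \<comment> \<open>The strings form a chain, so any one longer than \<open>n\<close> gives the same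
    value.\<close>
  define f where "f n = s (T n) ! n" for n
  have f: "f n = s t ! n" if "n < length (s t)" for n t
  proof -
    have "n < length (s (T n))"
      using T[of n] by simp
    moreover have "prefix (s t) (s (T n)) \<or> prefix (s (T n)) (s t)"
      using mono nat_le_linear by blast
    ultimately show ?thesis
      using that by (auto simp: f_def prefix_iff_nth)
  qed
  have seg: "s t = initial_segment f (length (s t))" for t
    by (simp add: list_eq_iff_nth_eq f[symmetric])
  have "range f = (\<Union>t. set (s t))"
  proof (intro equalityI subsetI)
    fix v assume "v \<in> range f"
    then obtain n where "v = s (T n) ! n"
      by (auto simp: f_def)
    then have "v \<in> set (s (T n))"
      using T[of n] by simp
    then show "v \<in> (\<Union>t. set (s t))"
      by blast
  next
    fix v assume "v \<in> (\<Union>t. set (s t))"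
    then obtain t n where "n < length (s t)" "v = s t ! n"
      by (auto simp: in_set_conv_nth)
    then have "v = f n"
      by (simp add: f[symmetric])
    then show "v \<in> range f"
      by blast
  qed
  then obtain n N where n: "\<And>i. N \<le> i \<Longrightarrow> M (initial_segment f i) = Some n"
    using learns unfolding txtex_star_learns_set_def txtex_star_identifies_def enumeration_of_def
    by metis
  obtain T where T: "N \<le> length (s T)"
    using long by blast
  obtain t r m m' where t: "t \<ge> T" "prefix (s t) r" "prefix r (s (Suc t))" "m \<noteq> m'" "M r = Some m"
      "M (s (Suc t)) = Some m'"
    using unstable[of T] by blast
  have "N \<le> length r" "N \<le> length (s (Suc t))"
    using T prefix_length_le[OF mono[OF t(1)]] prefix_length_le[OF t(2)] prefix_length_le[OF t(3)] by simp_all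
  moreover have "r = initial_segment f (length r)"
    using t(3) by (subst (asm) seg) (rule prefix_of_initial_segment)
  ultimately have "M r = Some n" "M (s (Suc t)) = Some n"
    using n[of "length r"] n[of "length (s (Suc t))"] seg[of "Suc t"] by simp_all
  with t show False
    by simp
qed

text \<open>An element admitted at stage \<open>t\<close> is at most \<open>t\<close>, and a bound raised later exceeds \<open>t\<close>. So what
  was admitted relative to an outdated bound ends up below the final one.\<close>

definition stage_set :: "(nat \<Rightarrow> nat) \<Rightarrow> nat \<Rightarrow> nat set \<Rightarrow> nat set" where
  "stage_set bd j U = {m. \<exists>t. m \<le> t \<and> (m < bd t \<or> m = bd t + j \<or> bd t + j < m \<and> m \<in> U)}"

section \<open>Settling and growth of the bound\<close>

lemma stage_mono:
  fixes bd :: "nat \<Rightarrow> nat"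
  assumes "bd 0 = 0" "\<And>t. bd (Suc t) = bd t \<or> bd (Suc t) = Suc t"
  shows "bd t \<le> t" "t \<le> t' \<Longrightarrow> bd t \<le> bd t'"
proof -
  show le: "bd t \<le> t" for t
    by (induction t) (use assms in \<open>auto simp: le_SucI\<close>, metis le_SucI order_refl)
  have "bd t \<le> bd (Suc t)" for t
    using assms(2)[of t] le[of t] by auto
  then show "t \<le> t' \<Longrightarrow> bd t \<le> bd t'"
    by (rule lift_Suc_mono_le)
qed

lemma stage_jump:
  fixes bd :: "nat \<Rightarrow> nat"
  assumes "bd 0 = 0" "\<And>t. bd (Suc t) = bd t \<or> bd (Suc t) = Suc t"
    and "t \<le> t'" "bd t \<noteq> bd t'"
  shows "t < bd t'"
  using assms(3,4)
proof (induction t' rule: dec_induct)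
  case (step n)
  then show ?case
    using assms(2)[of n] by (cases "bd t = bd n") auto
qed simp

lemma stage_set_stuck:
  assumes bd: "bd 0 = 0" "\<And>t. bd (Suc t) = bd t \<or> bd (Suc t) = Suc t"
    and stuck: "\<And>t. T \<le> t \<Longrightarrow> bd t = b"
  shows "stage_set bd j U = {..<b} \<union> {b + j} \<union> {m \<in> U. b + j < m}"
proof (intro equalityI subsetI)
  fix m assume "m \<in> stage_set bd j U"
  then obtain t where t: "m \<le> t" "m < bd t \<or> m = bd t + j \<or> bd t + j < m \<and> m \<in> U"
    by (auto simp: stage_set_def)
  have "bd t = b \<or> t < b"
    using stage_jump[OF bd max.cobounded1, of t T] stuck[OF max.cobounded2, of t] by metis
  with t show "m \<in> {..<b} \<union> {b + j} \<union> {m \<in> U. b + j < m}"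
    by auto
next
  fix m assume "m \<in> {..<b} \<union> {b + j} \<union> {m \<in> U. b + j < m}"
  then show "m \<in> stage_set bd j U"
    using stuck[of "max m T"] by (auto simp: stage_set_def intro!: exI[of _ "max m T"])
qed

lemma stage_set_unstuck:
  assumes bd: "bd 0 = 0" "\<And>t. bd (Suc t) = bd t \<or> bd (Suc t) = Suc t"
    and unstuck: "\<And>T b. \<exists>t\<ge>T. bd t \<noteq> b"
  shows "stage_set bd j U = UNIV"
proof -
  have "m \<in> stage_set bd j U" for m
  proof -
    obtain t where t: "t \<ge> m" "bd t \<noteq> bd m"
      using unstuck by blast
    then have "m < bd t"
      using stage_jump[OF bd, of m t] by auto
    with t(1) show ?thesis
      by (auto simp: stage_set_def)
  qed
  then show ?thesis
    by blast
qed

text \<open>Supplies the tag \<open>x\<close> at which the construction acts against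
  \<open>M\<close>. Coding machines by c.e. graphs lets the numbering of c.e. sets list all
  machines.\<close>

lemma learning_machine_graph:
  assumes "standard_numbering W" "learning_machine M"
  obtains x where "\<And>l n. prod_encode (list_encode l, n) \<in> W x \<longleftrightarrow> M l = Some n"
proof -
  obtain t where t: "\<forall>xs. length xs = 1 \<longrightarrow> (\<forall>y. M (list_decode (xs ! 0)) = Some y \<longleftrightarrow> evals t xs y)"
    using assms(2) by (auto simp: learning_machine_def partial_computable_def)
  have "semidecidable (\<lambda>u. evals t [fst (prod_decode (snd (prod_decode u)))] (snd (prod_decode (snd (prod_decode u)))))"
    by (intro semidecidable_evals computable_Cons computable_intros)
  from standard_numbering_index[OF assms(1) this] obtain h :: "nat \<Rightarrow> nat" where
    "\<And>e. W (h e) = {x. evals t [fst (prod_decode x)] (snd (prod_decode x))}"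
    by auto
  then have "prod_encode (list_encode l, n) \<in> W (h 0) \<longleftrightarrow> M l = Some n" for l n
    using t[rule_format, of "[list_encode l]" n] by simp
  then show ?thesis
    by (rule that)
qed

section \<open>The diagonal family\<close>

text \<open>Stage \<open>t\<close> is read as a pair of a candidate and a limit on the search for a
  witness of \<open>C\<close>. A candidate recurs with all limits, so a true instance at a settled
  bound would be discovered.\<close>

lemma stage_bound:
  fixes C :: "nat \<Rightarrow> nat \<Rightarrow> nat \<Rightarrow> bool"
  assumes "semidecidable (\<lambda>u. C (fst (prod_decode u)) (fst (prod_decode (snd (prod_decode u))))
    (snd (prod_decode (snd (prod_decode u)))))"
  obtains bd :: "nat \<Rightarrow> nat \<Rightarrow> nat" where
    "\<And>x t. computable x \<Longrightarrow> computable t \<Longrightarrow> computable (\<lambda>z. bd (x z) (t z))"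
    "\<And>x. bd x 0 = 0"
    "\<And>x t. bd x (Suc t) = bd x t \<or> bd x (Suc t) = Suc t \<and> C x (bd x t) (fst (prod_decode t))"
    "\<And>x T b c. (\<And>t. T \<le> t \<Longrightarrow> bd x t = b) \<Longrightarrow> \<not> C x b c"
proof -
  obtain A where A: "decidable A" "\<And>u. C (fst (prod_decode u)) (fst (prod_decode (snd (prod_decode u))))
    (snd (prod_decode (snd (prod_decode u)))) \<longleftrightarrow> (\<exists>w. A (prod_encode (w, u)))"
    using assms by (auto simp: semidecidable_def)
  have C: "C x b c \<longleftrightarrow> (\<exists>w. A (prod_encode (w, prod_encode (x, prod_encode (b, c)))))" for x b c
    using A(2)[of "prod_encode (x, prod_encode (b, c))"] by simp
  define cert where "cert x b t \<longleftrightarrow> (\<exists>w<snd (prod_decode t).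
    A (prod_encode (w, prod_encode (x, prod_encode (b, fst (prod_decode t))))))" for x b t
  define bd where "bd x t = rec_nat 0 (\<lambda>t b. if cert x b t then Suc t else b) t" for x t
  have bd_Suc: "bd x (Suc t) = (if cert x (bd x t) t then Suc t else bd x t)" for x t
    by (simp add: bd_def)
  show ?thesis
  proof (rule that[of bd])
    show "computable (\<lambda>z. bd (x z) (t z))" if "computable x" "computable t" for x t
      unfolding bd_def cert_def
      by (intro computable_rec_nat computable_If decidable_intros decidable_comp[OF A(1)] computable_intros
          that[THEN computable_comp])
    show "bd x 0 = 0" for x
      by (simp add: bd_def)
    show "bd x (Suc t) = bd x t \<or> bd x (Suc t) = Suc t \<and> C x (bd x t) (fst (prod_decode t))" for x t
      by (auto simp: bd_Suc cert_def C)
    show "\<not> C x b c" if stuck: "\<And>t. T \<le> t \<Longrightarrow> bd x t = b" for x T b c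
    proof
      assume "C x b c"
      then obtain w where w: "A (prod_encode (w, prod_encode (x, prod_encode (b, c))))"
        by (auto simp: C)
      \<comment> \<open>Exceeding \<open>w\<close> confirms the instance, exceeding \<open>T\<close>
        puts the stage after the settling, and exceeding \<open>b\<close> makes the new bound
        \<open>Suc t\<close> differ from \<open>b\<close>.\<close>
      define t where "t = prod_encode (c, Suc (w + T + b))"
      have "Suc (w + T + b) \<le> t"
        unfolding t_def by (rule le_prod_encode_2)
      moreover have "cert x b t"
        using w by (auto simp: cert_def t_def intro!: exI[of _ w])
      ultimately show False
        using stuck[of t] stuck[of "Suc t"] by (simp add: bd_Suc)
    qed
  qed
qed

text \<open>A bound \<open>b = Suc t\<close> records the certificate \<open>t\<close>, a pair of a string and a witness, that raised it;
  the initial bound \<open>0\<close> yields the empty string.\<close>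

definition stage_string :: "nat \<Rightarrow> nat list" where
  "stage_string b = list_decode (fst (prod_decode (b - 1)))"

text \<open>Covering all tagged numbers below \<open>b\<close> makes the strings converge to a text
  for the whole part if the bound keeps growing. Only positive membership in \<open>W x\<close> is
  used, which keeps the condition semidecidable and meaningful even if \<open>W x\<close> is not a
  graph.\<close>

definition mind_change :: "(nat \<Rightarrow> nat set) \<Rightarrow> nat \<Rightarrow> nat \<Rightarrow> nat \<Rightarrow> bool" where
  "mind_change W x b c \<longleftrightarrow> (\<exists>r n n'. prefix (stage_string b) (list_decode r) \<and>
     prefix (list_decode r) (list_decode c) \<and> set (list_decode c) \<subseteq> range (\<lambda>m. prod_encode (x, m)) \<and>
     (\<forall>m<b. prod_encode (x, m) \<in> set (list_decode c)) \<and> n \<noteq> n' \<and>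
     prod_encode (r, n) \<in> W x \<and> prod_encode (c, n') \<in> W x)"

section \<open>Semidecidability of the mind-change condition\<close>

lemma decidable_prefix:
  assumes "computable a" "computable b"
  shows "decidable (\<lambda>z. prefix (list_decode (a z)) (list_decode (b z)))"
proof -
  have "prefix (list_decode a) (list_decode b) \<longleftrightarrow> length (list_decode a) \<le> length (list_decode b) \<and>
      (\<forall>i<length (list_decode a). code_nth a i = code_nth b i)" for a b
    by (auto simp: prefix_iff_nth code_nth)
  then show ?thesis
    by (simp only:) (intro decidable_intros computable_code_nth computable_length computable_list_decode
      computable_intros assms[THEN computable_comp] assms)
qed

lemma decidable_member:
  assumes "computable a" "computable b"
  shows "decidable (\<lambda>z. a z \<in> set (list_decode (b z)))"
proof -
  have "v \<in> set (list_decode c) \<longleftrightarrow> (\<exists>i<length (list_decode c). code_nth c i = v)" for v c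
    by (auto simp: in_set_conv_nth code_nth)
  then show ?thesis
    by (simp only:) (intro decidable_intros computable_code_nth computable_length computable_list_decode
      computable_intros assms[THEN computable_comp] assms)
qed

lemma decidable_tagged:
  assumes "computable x" "computable c"
  shows "decidable (\<lambda>z. set (list_decode (c z)) \<subseteq> range (\<lambda>m. prod_encode (x z, m)))"
proof -
  have "v \<in> range (\<lambda>m. prod_encode (x, m)) \<longleftrightarrow> fst (prod_decode v) = x" for v x
  proof -
    obtain a b where "v = prod_encode (a, b)"
      by (metis prod_decode_inverse surj_pair)
    then show ?thesis
      by auto
  qed
  then have tagged: "set (list_decode c) \<subseteq> range (\<lambda>m. prod_encode (x, m)) \<longleftrightarrow>
      (\<forall>i<length (list_decode c). fst (prod_decode (code_nth c i)) = x)" for x c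
    by (simp add: subset_eq all_set_conv_all_nth code_nth)
  show ?thesis
    unfolding tagged by (intro decidable_intros computable_code_nth computable_length computable_list_decode
      computable_intros assms[THEN computable_comp] assms)
qed

lemma semidecidable_mind_change:
  assumes "standard_numbering W"
  shows "semidecidable (\<lambda>u. mind_change W (fst (prod_decode u)) (fst (prod_decode (snd (prod_decode u))))
    (snd (prod_decode (snd (prod_decode u)))))"
  unfolding mind_change_def stage_string_def
  by (intro semidecidable_ex semidecidable_conj standard_numbering_semidecidable[OF assms]
      semidecidable_decidable[OF decidable_prefix] semidecidable_decidable[OF decidable_tagged]
      semidecidable_decidable[OF decidable_ball] decidable_member
      semidecidable_decidable[OF decidable_not[OF decidable_eq]] computable_intros)

text \<open>At an index \<open>x\<close> of the graph of \<open>M\<close> both outcomes are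
  contradictory: a settled bound makes some \<open>- U x j\<close> finite, and an unsettled one
  yields a text for column 0 without a limit.\<close>

lemma no_machine_learns:
  fixes U :: "nat \<Rightarrow> nat \<Rightarrow> nat set" and bd :: "nat \<Rightarrow> nat \<Rightarrow> nat"
  assumes W: "standard_numbering W"
    and bd: "\<And>x. bd x 0 = 0"
      "\<And>x t. bd x (Suc t) = bd x t \<or> bd x (Suc t) = Suc t \<and> mind_change W x (bd x t) (fst (prod_decode t))"
      "\<And>x T b c. (\<And>t. T \<le> t \<Longrightarrow> bd x t = b) \<Longrightarrow> \<not> mind_change W x b c"
    and U: "\<And>x. U x 0 = UNIV" "\<And>x. \<exists>j. infinite (- U x j)"
    and M: "learning_machine M"
    and learns: "\<And>x j. txtex_star_learns_set W M ((\<lambda>m. prod_encode (x, m)) ` stage_set (bd x) j (U x j))"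
  shows False
proof -
  obtain x where x: "\<And>l n. prod_encode (list_encode l, n) \<in> W x \<longleftrightarrow> M l = Some n"
    using learning_machine_graph[OF W M] by blast
  have step: "bd x (Suc t) = bd x t \<or> bd x (Suc t) = Suc t" for t
    using bd(2) by blast
  note mono = stage_mono[of "bd x", OF bd(1) step]
  have change: "\<exists>r n n'. prefix (stage_string b) r \<and> prefix r (list_decode c) \<and> n \<noteq> n' \<and>
      M r = Some n \<and> M (list_decode c) = Some n'" if "mind_change W x b c" for b c
    using that x[of "list_decode _"] unfolding mind_change_def by (metis list_decode_inverse)
  show False
  proof (cases "\<exists>T b. \<forall>t\<ge>T. bd x t = b")
    case True
    then obtain T b where stuck: "\<And>t. T \<le> t \<Longrightarrow> bd x t = b" by blast
    obtain j where j: "infinite (- U x j)" using U(2) by blast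
    have Z: "stage_set (bd x) j U' = {..<b} \<union> {b + j} \<union> {m \<in> U'. b + j < m}" for j U'
      by (rule stage_set_stuck[OF bd(1) step stuck])
    \<comment> \<open>The string comes from the initial bound 0 and is empty, or from a certificate
      \<open>t\<close> with \<open>b = Suc t\<close>, whose entries lie below \<open>b\<close>.
      Hence it is contained in every column of the part.\<close>
    have string: "set (stage_string b) \<subseteq> (\<lambda>m. prod_encode (x, m)) ` {..<b}"
    proof (cases "bd x T = 0")
      case True
      then show ?thesis
        using stuck[of T] by (simp add: stage_string_def prod_decode_def prod_decode_aux.simps)
    next
      case False
      have origin: "bd x t = 0 \<or> (\<exists>t'. bd x t = Suc t' \<and> set (list_decode (fst (prod_decode t'))) \<subseteq> range (\<lambda>m. prod_encode (x, m)))" for t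
      proof (induction t)
        case (Suc t)
        then show ?case
          using bd(2)[of x t] by (auto simp: mind_change_def)
      qed (simp add: bd(1))
      then obtain t where t: "b = Suc t" "set (list_decode (fst (prod_decode t))) \<subseteq> range (\<lambda>m. prod_encode (x, m))"
        using False stuck[of T] origin[of T] by auto
      show ?thesis
      proof
        fix v assume v: "v \<in> set (stage_string b)"
        then obtain m where m: "v = prod_encode (x, m)"
          using t by (auto simp: stage_string_def)
        have "v < fst (prod_decode t)"
          using elem_less_list_encode[OF v] by (simp add: stage_string_def t)
        also have "fst (prod_decode t) \<le> t"
          by (metis le_prod_encode_1 prod_decode_inverse surjective_pairing)
        finally have "m < b"
          using le_prod_encode_2[of m x] by (simp add: m t)
        with m show "v \<in> (\<lambda>m. prod_encode (x, m)) ` {..<b}"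
          by simp
      qed
    qed
    have "stage_set (bd x) 0 (U x 0) = UNIV"
      unfolding Z by (auto simp: U(1))
    with learns[of x 0] have "txtex_star_learns_set W M (range (\<lambda>m. prod_encode (x, m)))"
      by simp
    then have "finite (- stage_set (bd x) j (U x j))"
    proof (rule stuck_machine_fails[OF _ learns])
      show "stage_set (bd x) j (U x j) \<noteq> {}"
        unfolding Z by auto
      show "set (stage_string b) \<subseteq> (\<lambda>m. prod_encode (x, m)) ` stage_set (bd x) j (U x j)"
        using string unfolding Z by blast
      fix r c n n'
      assume "prefix (stage_string b) r" "prefix r c" "set c \<subseteq> range (\<lambda>m. prod_encode (x, m))"
        "\<forall>m<b. prod_encode (x, m) \<in> set c" "M r = Some n" "M c = Some n'"
      \<comment> \<open>Two different conjectures would form a certificate for the settled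
        bound.\<close>
      then have "n \<noteq> n' \<Longrightarrow> mind_change W x b (list_encode c)"
        unfolding mind_change_def by (intro exI[of _ "list_encode r"] exI[of _ n] exI[of _ n']) (simp add: x)
      then show "n = n'"
        using bd(3)[OF stuck] by blast
    qed
    moreover have "- U x j \<subseteq> - stage_set (bd x) j (U x j) \<union> {..b + j}"
      unfolding Z by auto
    ultimately show False
      using j by (meson finite_UnI finite_atMost finite_subset)
  next
    case False
    have Z: "stage_set (bd x) j U' = UNIV" for j U'
      by (rule stage_set_unstuck[OF bd(1) step]) (use False in blast)
    define s where "s t = stage_string (bd x t)" for t
    have s_change: "mind_change W x (bd x t) (fst (prod_decode t)) \<and> s (Suc t) = list_decode (fst (prod_decode t)) \<and>
        bd x (Suc t) = Suc t" if "bd x (Suc t) \<noteq> bd x t" for t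
      using bd(2)[of x t] that by (auto simp: s_def stage_string_def)
    have unbounded: "\<exists>t\<ge>T. bd x (Suc t) \<noteq> bd x t" for T
    proof (rule ccontr)
      assume *: "\<not> ?thesis"
      have "bd x t = bd x T" if "T \<le> t" for t
        using that by (induction rule: dec_induct) (use * in auto)
      with False show False by blast
    qed
    have chain: "prefix (s t) (s (Suc t))" for t
    proof (cases "bd x (Suc t) = bd x t")
      case False
      then show ?thesis
        using s_change[OF False] change by (metis s_def prefix_order.trans)
    qed (simp add: s_def)
    have "\<exists>r n n'. prefix (s t) r \<and> prefix r (s (Suc t)) \<and> n \<noteq> n' \<and> M r = Some n \<and> M (s (Suc t)) = Some n'"
      if "bd x (Suc t) \<noteq> bd x t" for t
      using s_change[OF that] change by (metis s_def)
    then have "\<not> txtex_star_learns_set W M (\<Union>t. set (s t))"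
      using unbounded by (intro unstable_machine_fails chain) blast
    moreover have "(\<Union>t. set (s t)) = range (\<lambda>m. prod_encode (x, m))"
    proof (intro equalityI subsetI)
      fix v assume "v \<in> (\<Union>t. set (s t))"
      then obtain t where "v \<in> set (s t)" by blast
      moreover have "set (s t) \<subseteq> range (\<lambda>m. prod_encode (x, m))"
      proof (induction t)
        case 0
        then show ?case
          by (simp add: s_def bd(1) stage_string_def prod_decode_def prod_decode_aux.simps)
      next
        case (Suc t)
        then show ?case
          using s_change[of t] by (cases "bd x (Suc t) = bd x t") (auto simp: s_def mind_change_def)
      qed
      ultimately show "v \<in> range (\<lambda>m. prod_encode (x, m))"
        by blast
    next
      fix v assume "v \<in> range (\<lambda>m. prod_encode (x, m))"
      then obtain m where m: "v = prod_encode (x, m)" by blast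
      \<comment> \<open>Two changes are needed: the first raises the bound above \<open>m\<close>,
        the second must then cover \<open>m\<close>.\<close>
      obtain t where t: "t \<ge> m" "bd x (Suc t) \<noteq> bd x t"
        using unbounded by blast
      obtain t' where t': "t' \<ge> Suc t" "bd x (Suc t') \<noteq> bd x t'"
        using unbounded by blast
      have "m < bd x t'"
        using mono(2)[OF t'(1)] s_change[OF t(2)] t(1) by simp
      then have "v \<in> set (s (Suc t'))"
        using s_change[OF t'(2)] by (auto simp: mind_change_def m)
      then show "v \<in> (\<Union>t. set (s t))"
        by blast
    qed
    ultimately show False
      using learns[of x 0] by (simp add: Z)
  qed
qed

text \<open>A finite table is a constant; in this way finite information that cannot be found
  effectively enters the learner.\<close>

lemma computable_finite_support:
  assumes "\<And>x. n \<le> x \<Longrightarrow> f x = 0"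
  shows "computable f"
proof -
  have "computable (\<lambda>x. if x < n then code_nth (list_encode (map f [0..<n])) x else 0)"
    by (intro computable_If decidable_intros computable_intros computable_code_nth)
  moreover have "(\<lambda>x. if x < n then code_nth (list_encode (map f [0..<n])) x else 0) = f"
    using assms by (auto simp: code_nth_list_encode)
  ultimately show ?thesis
    by simp
qed

text \<open>Where the final bound is known, the least element at or above it is the marker, which
  reveals \<open>j\<close>. Elsewhere all columns of the part agree up to finitely many elements, so
  every conjecture about \<open>j\<close> is correct.\<close>

lemma finitely_many_bad_learnable:
  fixes U :: "nat \<Rightarrow> nat \<Rightarrow> nat set" and bd :: "nat \<Rightarrow> nat \<Rightarrow> nat"
  assumes bd: "\<And>x. bd x 0 = 0" "\<And>x t. bd x (Suc t) = bd x t \<or> bd x (Suc t) = Suc t"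
    and U: "\<And>x j. x0 \<le> x \<Longrightarrow> finite (- U x j)"
    and g: "computable g"
      "\<And>x j. W (g (prod_encode (x, j))) = (\<lambda>m. prod_encode (x, m)) ` stage_set (bd x) j (U x j)"
  shows "txtex_star_learnable W (range (\<lambda>i. (\<lambda>m. prod_encode (fst (prod_decode i), m)) `
    stage_set (bd (fst (prod_decode i))) (snd (prod_decode i)) (U (fst (prod_decode i)) (snd (prod_decode i)))))"
proof -
  \<comment> \<open>The advice: the final bounds of the settled parts below \<open>x0\<close>, and 0
    everywhere else.\<close>
  define \<beta> where "\<beta> x = (if x < x0 \<and> (\<exists>T b. \<forall>t\<ge>T. bd x t = b) then
      (SOME b. \<exists>T. \<forall>t\<ge>T. bd x t = b) else 0)" for x
  have cases: "(\<forall>j. stage_set (bd x) j (U x j) = UNIV) \<or>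
      (\<exists>b. (x0 \<le> x \<and> \<beta> x = 0 \<or> \<beta> x = b) \<and>
        (\<forall>j. stage_set (bd x) j (U x j) = {..<b} \<union> {b + j} \<union> {m \<in> U x j. b + j < m}))" for x
  proof (cases "\<exists>T b. \<forall>t\<ge>T. bd x t = b")
    case True
    then have "\<exists>T. \<forall>t\<ge>T. bd x t = (SOME b. \<exists>T. \<forall>t\<ge>T. bd x t = b)"
      by (intro someI_ex[of "\<lambda>b. \<exists>T. \<forall>t\<ge>T. bd x t = b"]) blast
    then obtain T where T: "\<And>t. T \<le> t \<Longrightarrow> bd x t = (SOME b. \<exists>T. \<forall>t\<ge>T. bd x t = b)"
      by blast
    have "x0 \<le> x \<and> \<beta> x = 0 \<or> \<beta> x = (SOME b. \<exists>T. \<forall>t\<ge>T. bd x t = b)"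
      using True by (auto simp: \<beta>_def)
    then show ?thesis
      using stage_set_stuck[of "bd x", OF bd T] by blast
  next
    case False
    then show ?thesis
      using stage_set_unstuck[of "bd x", OF bd] by blast
  qed
  show ?thesis
  proof (rule learnable_by_least_element[OF g, of \<beta>])
    show "computable \<beta>"
      by (rule computable_finite_support[of x0]) (simp add: \<beta>_def)
    show "\<exists>k. \<beta> x + k \<in> stage_set (bd x) j (U x j)" for x j
      using cases[of x] by (elim disjE exE conjE) (auto intro: exI[of _ j] exI[of _ "_ + j"])
    show "stage_set (bd x) (LEAST k. \<beta> x + k \<in> stage_set (bd x) j (U x j))
      (U x (LEAST k. \<beta> x + k \<in> stage_set (bd x) j (U x j))) =\<^sup>* stage_set (bd x) j (U x j)" for x j
      using cases[of x]
    proof (elim disjE exE conjE)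
      assume "\<forall>j. stage_set (bd x) j (U x j) = UNIV"
      then show ?thesis
        by (simp add: eq_star_def)
    next
      fix b
      assume b: "x0 \<le> x" "\<forall>j. stage_set (bd x) j (U x j) = {..<b} \<union> {b + j} \<union> {m \<in> U x j. b + j < m}"
      have "finite (- stage_set (bd x) j (U x j))" for j
      proof -
        have "- stage_set (bd x) j (U x j) \<subseteq> - U x j \<union> {..b + j}"
          using b(2) by auto
        then show ?thesis
          using U[OF b(1)] by (meson finite_UnI finite_atMost finite_subset)
      qed
      moreover have "sym_diff A B \<subseteq> - A \<union> - B" for A B :: "nat set"
        by blast
      ultimately show ?thesis
        unfolding eq_star_def by (meson finite_UnI finite_subset)
    next
      fix b
      assume b: "\<beta> x = b" "\<forall>j. stage_set (bd x) j (U x j) = {..<b} \<union> {b + j} \<union> {m \<in> U x j. b + j < m}"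
      \<comment> \<open>No element of the column lies between the bound and the marker
        \<open>b + j\<close>.\<close>
      have "(LEAST k. \<beta> x + k \<in> stage_set (bd x) j (U x j)) = j"
        by (rule Least_equality) (use b in auto)
      then show ?thesis
        by (simp add: eq_star_def)
    qed
  qed
qed

section \<open>Assembling the reduction\<close>

theorem theorem5p3:
  fixes W :: "nat \<Rightarrow> nat set"
  assumes "standard_numbering W"
  shows "\<forall>P. sigma_pred 5 P \<longrightarrow> (\<exists>h. computable h \<and> (\<forall>e. P e \<longleftrightarrow> h e \<in> EXL_star W))"
proof (intro allI impI)
  fix P :: "nat \<Rightarrow> bool"
  assume "sigma_pred 5 P"
  then obtain V where V: "semidecidable (\<lambda>u. fst (prod_decode u) \<in> V (snd (prod_decode u)))"
    "\<And>e. P e \<Longrightarrow> \<exists>x0. \<forall>x\<ge>x0. \<forall>y. finite (- V (prod_encode (e, prod_encode (x, y))))"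
    "\<And>e x. \<not> P e \<Longrightarrow> \<exists>y. infinite (- V (prod_encode (e, prod_encode (x, y))))"
    by (rule sigma5_cofinite_form) blast
  \<comment> \<open>The bounds are independent of \<open>e\<close>: part \<open>x\<close> always
    acts against \<open>W x\<close>.\<close>
  obtain bd where bd: "\<And>x t. computable x \<Longrightarrow> computable t \<Longrightarrow> computable (\<lambda>z. bd (x z) (t z))"
    "\<And>x. bd x 0 = 0"
    "\<And>x t. bd x (Suc t) = bd x t \<or> bd x (Suc t) = Suc t \<and> mind_change W x (bd x t) (fst (prod_decode t))"
    "\<And>x T b c. (\<And>t. T \<le> t \<Longrightarrow> bd x t = b) \<Longrightarrow> \<not> mind_change W x b c"
    using stage_bound[OF semidecidable_mind_change[OF assms]] by blast
  \<comment> \<open>Column 0 is reserved for the full set, so column \<open>j\<close> takes the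
    challenge \<open>j - 1\<close>.\<close>
  define U where "U e x j = {m. j = 0 \<or> m \<in> V (prod_encode (e, prod_encode (x, j - 1)))}" for e x j
  define Z where "Z e x j = stage_set (bd x) j (U e x j)" for e x j
  have Z: "semidecidable (\<lambda>u. m u \<in> Z (e u) (x u) (j u))"
    if "computable e" "computable x" "computable j" "computable m" for e x j m
  proof -
    have V': "semidecidable (\<lambda>u. a u \<in> V (b u))" if "computable a" "computable b" for a b
      using semidecidable_subst[OF V(1) that] .
    show ?thesis
      unfolding Z_def stage_set_def U_def mem_Collect_eq
      by (intro semidecidable_ex semidecidable_conj semidecidable_disj V'
          semidecidable_decidable[OF decidable_le] semidecidable_decidable[OF decidable_less]
          semidecidable_decidable[OF decidable_eq] bd(1) computable_intros that[THEN computable_comp])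
  qed
  have member: "v \<in> (\<lambda>m. prod_encode (x, m)) ` A \<longleftrightarrow> fst (prod_decode v) = x \<and> snd (prod_decode v) \<in> A" for v x A
    by (metis (no_types, lifting) fst_conv imageE image_eqI prod_decode_inverse prod_encode_inverse snd_conv
        surjective_pairing)
  \<comment> \<open>An element of \<open>W (h e)\<close> pairs a column index with a number; the
    index is itself a pair of a part and a column within it.\<close>
  obtain h where h: "computable h" "\<And>e. W (h e) = {u.
      snd (prod_decode u) \<in> (\<lambda>m. prod_encode (fst (prod_decode (fst (prod_decode u))), m)) `
        Z e (fst (prod_decode (fst (prod_decode u)))) (snd (prod_decode (fst (prod_decode u))))}"
  proof -
    have "semidecidable (\<lambda>v. snd (prod_decode (snd (prod_decode v))) \<in>
      (\<lambda>m. prod_encode (fst (prod_decode (fst (prod_decode (snd (prod_decode v))))), m)) `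
        Z (fst (prod_decode v)) (fst (prod_decode (fst (prod_decode (snd (prod_decode v))))))
          (snd (prod_decode (fst (prod_decode (snd (prod_decode v)))))))"
      unfolding member
      by (intro semidecidable_conj Z semidecidable_decidable[OF decidable_eq] computable_intros)
    from standard_numbering_index[OF assms this] show ?thesis
      by (elim exE conjE) (rule that, assumption, erule allE, erule trans, simp)
  qed
  have family: "uce_family W (h e) = range (\<lambda>i. (\<lambda>m. prod_encode (fst (prod_decode i), m)) `
      Z e (fst (prod_decode i)) (snd (prod_decode i)))" for e
    by (simp add: uce_family_def column_def h(2))
  have "P e \<longleftrightarrow> h e \<in> EXL_star W" for e
  proof
    assume "P e"
    then obtain x0 where x0: "\<And>x y. x0 \<le> x \<Longrightarrow> finite (- V (prod_encode (e, prod_encode (x, y))))"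
      using V(2) by blast
    have U: "finite (- U e x j)" if "x0 \<le> x" for x j
      using x0[OF that, of "j - 1"] by (rule finite_subset[rotated]) (auto simp: U_def)
    \<comment> \<open>For the fixed \<open>e\<close>, this yields indices \<open>g\<close> of the
      columns, which are the conjectures.\<close>
    have "semidecidable (\<lambda>v. snd (prod_decode v) \<in>
      (\<lambda>m. prod_encode (fst (prod_decode (fst (prod_decode v))), m)) `
        Z e (fst (prod_decode (fst (prod_decode v)))) (snd (prod_decode (fst (prod_decode v)))))"
      unfolding member
      by (intro semidecidable_conj Z semidecidable_decidable[OF decidable_eq] computable_intros)
    from standard_numbering_index[OF assms this] obtain g where
      "computable g" "\<And>x j. W (g (prod_encode (x, j))) = (\<lambda>m. prod_encode (x, m)) ` Z e x j"
      by auto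
    from finitely_many_bad_learnable[of bd x0 "U e" g W, OF bd(2) _ U this[unfolded Z_def]] bd(3)
    show "h e \<in> EXL_star W"
      by (auto simp: EXL_star_def family Z_def)
  next
    assume "h e \<in> EXL_star W"
    then obtain M where M: "learning_machine M" "txtex_star_learns_family W M (uce_family W (h e))"
      by (auto simp: EXL_star_def txtex_star_learnable_def)
    show "P e"
    proof (rule ccontr)
      assume "\<not> P e"
      show False
      proof (rule no_machine_learns[OF assms bd(2-4) _ _ M(1)])
        show "U e x 0 = UNIV" for x
          by (simp add: U_def)
        show "\<exists>j. infinite (- U e x j)" for x
        proof -
          obtain y where "infinite (- V (prod_encode (e, prod_encode (x, y))))"
            using V(3)[OF \<open>\<not> P e\<close>] by blast
          then have "infinite (- U e x (Suc y))"
            by (simp add: U_def Collect_mem_eq)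
          then show ?thesis ..
        qed
        show "txtex_star_learns_set W M ((\<lambda>m. prod_encode (x, m)) ` stage_set (bd x) j (U e x j))" for x j
        proof -
          have "(\<lambda>m. prod_encode (x, m)) ` Z e x j \<in> uce_family W (h e)"
            unfolding family by (rule image_eqI[of _ _ "prod_encode (x, j)"]) auto
          then show ?thesis
            using M(2) by (auto simp: txtex_star_learns_family_def Z_def)
        qed
      qed
    qed
  qed
  with h(1) show "\<exists>h. computable h \<and> (\<forall>e. P e \<longleftrightarrow> h e \<in> EXL_star W)"
    by blast
qed

end
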